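(* Let $\mathbf K$ be an AEC and $\lambda\geq\operatorname{LS}(\mathbf K)$ such that $\mathbf K$ is stable in $\lambda$ and $\mathbf K_\lambda$ has amalgamation, joint embedding and no maximal models, and let $\mathcal I$ be an independence relation on $\mathbf K_\lambda$ satisfying uniqueness, extension, universal continuity, and $(\geq\kappa)$-local character for some regular $\kappa\leq\lambda$. Write $\kappa^*=\kappa(\mathcal I,\mathbf K_\lambda,\leq^u_{\mathbf K})$. Suppose $L\leq_{\mathbf K}M$ are in $K_\lambda$, $L$ is a $(\lambda,\geq\kappa^* )$-limit model, and $p\in\mathbf{gS}(M)$. Then $p$ does not $\lambda$-fork over $L$ if and only if $p$ does not $\mathcal I$-fork over $L$.
   Context: $\mathbf K=(K,\leq_{\mathbf K})$ is an AEC; $\mathbf K_\lambda$ its models of size $\lambda$; $\mathbf{gtp}$, $\mathbf{gS}$ Galois types; stable in $\lambda$: $|\mathbf{gS}(M)|\leq\lambda$ for $M\in K_\lambda$. $M_0\leq^u_{\mathbf K}M$ (for $M_0,M\in K_\lambda$): $M_0\leq M$ and every $N\in K_\lambda$ extending $M_0$ embeds in $M$ over $M_0$. A $(\lambda,\delta)$-limit model is $M_\delta$ for a $\leq_{\mathbf K}$-increasing continuous chain $\langle M_i:i\leq\delta\rangle$ in $K_\lambda$ with $M_i\leq^u M_{i+1}$; for regular $\kappa\le\lambda$, a $(\lambda,\geq\kappa)$-limit model is a $(\lambda,\delta)$-limit model for some regular $\delta\in[\kappa,\lambda^+)$. Independence relation $\mathcal I$ on $\mathbf K_\lambda$: relation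 on $(M_0,a,M,N)$, $M_0\leq M\leq N$ in $K_\lambda$, $a\in N$, invariant under isomorphism, monotone (shrink $M$ above $M_0$; shrink/enlarge $N$ keeping $M\le N$, $a\in N$), base monotone (enlarge $M_0$ inside $M$). $p\in\mathbf{gS}(M)$ does not $\mathcal I$-fork over $M_0$ if $p=\mathbf{gtp}(a/M,N)$ with $\mathcal I(M_0,a,M,N)$. Uniqueness: types over $N$ not $\mathcal I$-forking over $M\le N$ agreeing on $M$ are equal. Extension: a type over $M$ not $\mathcal I$-forking over $M_0\le M$ has, for every $N\geq M$, an extension in $\mathbf{gS}(N)$ not $\mathcal I$-forking over $M_0$. For regular $\gamma$, $\gamma$-local character: for every $\leq^u$-increasing $\langle M_i:i<\gamma\rangle$ in $K_\lambda$ with union $M_\gamma$, each $p\in\mathbf{gS}(M_\gamma)$ does not $\mathcal I$-fork over some $M_i$; $\gamma$-universal continuity: for such chains, if $p\upharpoonright M_i$ does not $\mathcal I$-fork over $M_0$ for all $i$, then $p$ does not $\mathcal I$-fork over $M_0$. $(\geq\kappa)$-local character: for all regular $\gamma\ge\kappa$; universal continuity: for all infinite regular $\gamma$. $\kappa(\mathcal I,\mathbf K_\lambda,\leq^u_{\mathbf K})$: least $\mu\le\lambda$ such that for every regular $\delta\in[\mu,\lambda^+)$, every $\leq^u$-increasing continuous chain $\langle M_i:i\le\delta\rangle$ in $K_\lambda$ and every $p\in\mathbf{gS}(M_\delta)$, $p$ does not $\mathcal I$-fork over some $M_i$, $i<\delta$. $\lambda$-splitting: for $M\le N$ and $p\in\mathbf{gS}(N)$,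 $p$ $\lambda$-splits over $M$ if there are $N_1,N_2\in K_\lambda$ with $M\le N_l\le N$ and an isomorphism $f:N_1\cong N_2$ fixing $M$ with $f(p\upharpoonright N_1)\neq p\upharpoonright N_2$. For $M,N\in K_\lambda$, $p\in\mathbf{gS}(N)$ does not $\lambda$-fork over $M$ if there is $M_0\in K_\lambda$ with $M_0\leq^u_{\mathbf K}M$ such that $p$ does not $\lambda$-split over $M_0$. *)

theory Defs
  imports Main
begin

unbundle cardinal_syntax

text \<open>
  Cardinals and ordinals are (order types of) the well-orders of the BNF cardinal library.

  A proper class of structures is represented by the structures whose universe is a subset of an
  arbitrary type \<open>'a\<close>.  Every AEC restricts to such a class.  For the results about models of
  cardinality \<open>lam\<close> one needs more than \<open>lam\<close> elements in \<open>'a\<close> (room for isomorphic copies); this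
  is automatic as soon as there is a model of infinite cardinality \<open>lam\<close> and no such model is maximal,
  since otherwise some model would have an isomorphic copy with universe \<open>UNIV\<close>.  Well-orders on
  \<open>'a\<close> suffice to index chains, as a strictly increasing chain of subsets of \<open>'a\<close> has length of
  cardinality at most that of \<open>'a\<close>.
\<close>

section \<open>Structures\<close>

record ('f, 'r) vocabulary =
  funs :: "'f set"
  farity :: "'f \<Rightarrow> nat"
  rels :: "'r set"
  rarity :: "'r \<Rightarrow> nat"

record ('a, 'f, 'r) struct =
  univ :: "'a set"
  fint :: "'f \<Rightarrow> 'a list \<Rightarrow> 'a"
  rint :: "'r \<Rightarrow> 'a list set"

definition tuples :: "nat \<Rightarrow> 'a set \<Rightarrow> 'a list set" where
  "tuples n A = {xs. length xs = n \<and> set xs \<subseteq> A}"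

text \<open>Interpretations are normalised off the vocabulary and off the universe, so that equality of
  structures in HOL is the mathematical one.\<close>

definition is_struct :: "('f, 'r) vocabulary \<Rightarrow> ('a, 'f, 'r) struct \<Rightarrow> bool" where
  "is_struct V M \<longleftrightarrow>
     univ M \<noteq> {} \<and>
     (\<forall>f xs. if f \<in> funs V \<and> xs \<in> tuples (farity V f) (univ M)
             then fint M f xs \<in> univ M else fint M f xs = undefined) \<and>
     (\<forall>R. if R \<in> rels V then rint M R \<subseteq> tuples (rarity V R) (univ M) else rint M R = {})"

definition substruct ::
  "('f, 'r) vocabulary \<Rightarrow> ('a, 'f, 'r) struct \<Rightarrow> ('a, 'f, 'r) struct \<Rightarrow> bool" where
  "substruct V M N \<longleftrightarrow>
     is_struct V M \<and> is_struct V N \<and> univ M \<subseteq> univ N \<and>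
     (\<forall>f\<in>funs V. \<forall>xs\<in>tuples (farity V f) (univ M). fint M f xs = fint N f xs) \<and>
     (\<forall>R\<in>rels V. \<forall>xs\<in>tuples (rarity V R) (univ M). xs \<in> rint M R \<longleftrightarrow> xs \<in> rint N R)"

text \<open>Only the values of \<open>h\<close> on \<open>univ M\<close> matter.\<close>

definition is_iso ::
  "('f, 'r) vocabulary \<Rightarrow> ('a \<Rightarrow> 'a) \<Rightarrow> ('a, 'f, 'r) struct \<Rightarrow> ('a, 'f, 'r) struct \<Rightarrow> bool" where
  "is_iso V h M N \<longleftrightarrow>
     is_struct V M \<and> is_struct V N \<and> bij_betw h (univ M) (univ N) \<and>
     (\<forall>f\<in>funs V. \<forall>xs\<in>tuples (farity V f) (univ M). h (fint M f xs) = fint N f (map h xs)) \<and>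
     (\<forall>R\<in>rels V. \<forall>xs\<in>tuples (rarity V R) (univ M). xs \<in> rint M R \<longleftrightarrow> map h xs \<in> rint N R)"

definition fixes_pointwise :: "('a \<Rightarrow> 'a) \<Rightarrow> ('a, 'f, 'r) struct \<Rightarrow> bool" where
  "fixes_pointwise h M \<longleftrightarrow> (\<forall>x\<in>univ M. h x = x)"

text \<open>The union of a family of structures forming a chain under substructure.\<close>

definition union_struct ::
  "('f, 'r) vocabulary \<Rightarrow> 'i set \<Rightarrow> ('i \<Rightarrow> ('a, 'f, 'r) struct) \<Rightarrow> ('a, 'f, 'r) struct" where
  "union_struct V J M = \<lparr>
     univ = (\<Union>i\<in>J. univ (M i)),
     fint = (\<lambda>f xs.
       if f \<in> funs V \<and> (\<exists>i\<in>J. xs \<in> tuples (farity V f) (univ (M i)))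
       then fint (M (SOME i. i \<in> J \<and> xs \<in> tuples (farity V f) (univ (M i)))) f xs
       else undefined),
     rint = (\<lambda>R. \<Union>i\<in>J. rint (M i) R) \<rparr>"


section \<open>Ordinals, cardinals and chains\<close>

definition limit_ord :: "'i rel \<Rightarrow> bool" where
  "limit_ord r \<longleftrightarrow>
     Well_order r \<and> Field r \<noteq> {} \<and> (\<forall>i\<in>Field r. \<exists>j\<in>Field r. j \<noteq> i \<and> (i, j) \<in> r)"

definition regular :: "'i rel \<Rightarrow> bool" where
  "regular r \<longleftrightarrow> Cinfinite r \<and> regularCard r"

definition least_card :: "('i rel \<Rightarrow> bool) \<Rightarrow> 'i rel" where
  "least_card P = (SOME \<mu>. Card_order \<mu> \<and> P \<mu> \<and> (\<forall>\<nu>. Card_order \<nu> \<and> P \<nu> \<longrightarrow> \<mu> \<le>o \<nu>))"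

definition is_succ_of :: "'i rel \<Rightarrow> 'i \<Rightarrow> 'i \<Rightarrow> bool" where
  "is_succ_of r i j \<longleftrightarrow> j \<noteq> i \<and> (i, j) \<in> r \<and> (\<forall>k. k \<noteq> i \<and> (i, k) \<in> r \<longrightarrow> (j, k) \<in> r)"

definition is_limit_in :: "'i rel \<Rightarrow> 'i \<Rightarrow> bool" where
  "is_limit_in r i \<longleftrightarrow>
     i \<in> Field r \<and> underS r i \<noteq> {} \<and> (\<forall>j\<in>underS r i. \<exists>k\<in>underS r i. k \<noteq> j \<and> (j, k) \<in> r)"

text \<open>A chain \<open>\<langle>M i : i < r\<rangle>\<close> is a function on the field of the well-order \<open>r\<close>.\<close>

definition increasing :: "('m \<Rightarrow> 'm \<Rightarrow> bool) \<Rightarrow> 'i rel \<Rightarrow> ('i \<Rightarrow> 'm) \<Rightarrow> bool" where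
  "increasing R r M \<longleftrightarrow> (\<forall>i j. (i, j) \<in> r \<and> i \<noteq> j \<longrightarrow> R (M i) (M j))"

definition continuous_chain ::
  "('f, 'r) vocabulary \<Rightarrow> 'i rel \<Rightarrow> ('i \<Rightarrow> ('a, 'f, 'r) struct) \<Rightarrow> bool" where
  "continuous_chain V r M \<longleftrightarrow> (\<forall>i. is_limit_in r i \<longrightarrow> M i = union_struct V (underS r i) M)"


section \<open>Abstract elementary classes\<close>

record ('a, 'f, 'r) abs_class =
  voc :: "('f, 'r) vocabulary"
  models :: "('a, 'f, 'r) struct set"
  le :: "('a, 'f, 'r) struct \<Rightarrow> ('a, 'f, 'r) struct \<Rightarrow> bool" (infix \<open>\<preceq>\<index>\<close> 50)

definition LS_bound :: "('a, 'f, 'r) abs_class \<Rightarrow> 'i rel \<Rightarrow> bool" where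
  "LS_bound K \<mu> \<longleftrightarrow>
     Cinfinite \<mu> \<and> |funs (voc K) <+> rels (voc K)| \<le>o \<mu> \<and>
     (\<forall>M\<in>models K. \<forall>A\<subseteq>univ M. \<exists>N. N \<preceq>\<^bsub>K\<^esub> M \<and> A \<subseteq> univ N \<and> |univ N| \<le>o |A| +c \<mu>)"

text \<open>The index type is large enough for such a cardinal always to exist.\<close>

definition LS :: "('a, 'f, 'r) abs_class \<Rightarrow> ('a + 'f + 'r + nat) rel" where
  "LS K = least_card (LS_bound K)"

definition AEC :: "('a, 'f, 'r) abs_class \<Rightarrow> bool" where
  "AEC K \<longleftrightarrow>
     (\<forall>M\<in>models K. is_struct (voc K) M) \<and>
     (\<forall>M N h. M \<in> models K \<and> is_iso (voc K) h M N \<longrightarrow> N \<in> models K) \<and>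
     (\<forall>M N M' N' h. M \<preceq>\<^bsub>K\<^esub> N \<and> is_iso (voc K) h N N' \<and> is_iso (voc K) h M M' \<longrightarrow> M' \<preceq>\<^bsub>K\<^esub> N') \<and>
     (\<forall>M N. M \<preceq>\<^bsub>K\<^esub> N \<longrightarrow> M \<in> models K \<and> N \<in> models K \<and> substruct (voc K) M N) \<and>
     (\<forall>M\<in>models K. M \<preceq>\<^bsub>K\<^esub> M) \<and>
     (\<forall>M N P. M \<preceq>\<^bsub>K\<^esub> N \<and> N \<preceq>\<^bsub>K\<^esub> P \<longrightarrow> M \<preceq>\<^bsub>K\<^esub> P) \<and>
     \<comment> \<open>coherence\<close>
     (\<forall>M N P. M \<preceq>\<^bsub>K\<^esub> P \<and> N \<preceq>\<^bsub>K\<^esub> P \<and> substruct (voc K) M N \<longrightarrow> M \<preceq>\<^bsub>K\<^esub> N) \<and>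
     \<comment> \<open>Tarski-Vaught axioms, including smoothness\<close>
     (\<forall>(r :: 'a rel) M. limit_ord r \<and> (\<forall>i\<in>Field r. M i \<in> models K) \<and> increasing (le K) r M \<longrightarrow>
        union_struct (voc K) (Field r) M \<in> models K \<and>
        (\<forall>i\<in>Field r. M i \<preceq>\<^bsub>K\<^esub> union_struct (voc K) (Field r) M) \<and>
        (\<forall>N. (\<forall>i\<in>Field r. M i \<preceq>\<^bsub>K\<^esub> N) \<longrightarrow> union_struct (voc K) (Field r) M \<preceq>\<^bsub>K\<^esub> N)) \<and>
     (\<exists>\<mu> :: ('a + 'f + 'r + nat) rel. LS_bound K \<mu>)"

definition models_of_card :: "('a, 'f, 'r) abs_class \<Rightarrow> 'i rel \<Rightarrow> ('a, 'f, 'r) struct set" where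
  "models_of_card K lam = {M \<in> models K. |univ M| =o lam}"

definition K_embedding ::
  "('a, 'f, 'r) abs_class \<Rightarrow> ('a \<Rightarrow> 'a) \<Rightarrow> ('a, 'f, 'r) struct \<Rightarrow> ('a, 'f, 'r) struct \<Rightarrow> bool" where
  "K_embedding K h M N \<longleftrightarrow> (\<exists>M'. is_iso (voc K) h M M' \<and> M' \<preceq>\<^bsub>K\<^esub> N)"

definition amalgamation :: "('a, 'f, 'r) abs_class \<Rightarrow> 'i rel \<Rightarrow> bool" where
  "amalgamation K lam \<longleftrightarrow>
     (\<forall>M0\<in>models_of_card K lam. \<forall>M1\<in>models_of_card K lam. \<forall>M2\<in>models_of_card K lam.
        M0 \<preceq>\<^bsub>K\<^esub> M1 \<and> M0 \<preceq>\<^bsub>K\<^esub> M2 \<longrightarrow>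
        (\<exists>N\<in>models_of_card K lam. \<exists>h1 h2.
           K_embedding K h1 M1 N \<and> fixes_pointwise h1 M0 \<and>
           K_embedding K h2 M2 N \<and> fixes_pointwise h2 M0))"

definition joint_embedding :: "('a, 'f, 'r) abs_class \<Rightarrow> 'i rel \<Rightarrow> bool" where
  "joint_embedding K lam \<longleftrightarrow>
     (\<forall>M1\<in>models_of_card K lam. \<forall>M2\<in>models_of_card K lam.
        \<exists>N\<in>models_of_card K lam. \<exists>h1 h2. K_embedding K h1 M1 N \<and> K_embedding K h2 M2 N)"

definition no_maximal_models :: "('a, 'f, 'r) abs_class \<Rightarrow> 'i rel \<Rightarrow> bool" where
  "no_maximal_models K lam \<longleftrightarrow>
     (\<forall>M\<in>models_of_card K lam. \<exists>N\<in>models_of_card K lam. M \<preceq>\<^bsub>K\<^esub> N \<and> N \<noteq> M)"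


section \<open>Galois types\<close>

type_synonym ('a, 'f, 'r) triple = "'a \<times> ('a, 'f, 'r) struct \<times> ('a, 'f, 'r) struct"
type_synonym ('a, 'f, 'r) gtype = "('a, 'f, 'r) triple set"

text \<open>A triple \<open>(a, M, N)\<close> stands for an element \<open>a\<close> of \<open>N\<close>, to be typed over \<open>M \<preceq> N\<close>.\<close>

definition atomic_equiv :: "('a, 'f, 'r) abs_class \<Rightarrow> ('a, 'f, 'r) triple rel" where
  "atomic_equiv K =
     {((a, M, N1), (b, M', N2)) | a M N1 b M' N2.
        M = M' \<and> M \<preceq>\<^bsub>K\<^esub> N1 \<and> a \<in> univ N1 \<and> M \<preceq>\<^bsub>K\<^esub> N2 \<and> b \<in> univ N2 \<and>
        (\<exists>N\<in>models K. \<exists>h1 h2.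
           K_embedding K h1 N1 N \<and> fixes_pointwise h1 M \<and>
           K_embedding K h2 N2 N \<and> fixes_pointwise h2 M \<and> h1 a = h2 b)}"

definition gtp ::
  "('a, 'f, 'r) abs_class \<Rightarrow> 'a \<Rightarrow> ('a, 'f, 'r) struct \<Rightarrow> ('a, 'f, 'r) struct \<Rightarrow> ('a, 'f, 'r) gtype" where
  "gtp K a M N = (atomic_equiv K)\<^sup>+ `` {(a, M, N)}"

definition gS :: "('a, 'f, 'r) abs_class \<Rightarrow> ('a, 'f, 'r) struct \<Rightarrow> ('a, 'f, 'r) gtype set" where
  "gS K M = {gtp K a M N | a N. M \<preceq>\<^bsub>K\<^esub> N \<and> a \<in> univ N}"

definition stable_in :: "('a, 'f, 'r) abs_class \<Rightarrow> 'i rel \<Rightarrow> bool" where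
  "stable_in K lam \<longleftrightarrow> (\<forall>M\<in>models_of_card K lam. |gS K M| \<le>o lam)"

text \<open>The restriction to \<open>M0\<close> and the image under an isomorphism \<open>f\<close> onto \<open>N2\<close>; neither depends
  on the chosen representative of \<open>p\<close> (nor, for the image, on the extension \<open>g\<close> of \<open>f\<close>).\<close>

definition restrict_type ::
  "('a, 'f, 'r) abs_class \<Rightarrow> ('a, 'f, 'r) gtype \<Rightarrow> ('a, 'f, 'r) struct \<Rightarrow> ('a, 'f, 'r) gtype" where
  "restrict_type K p M0 = (SOME q. \<exists>a M N. (a, M, N) \<in> p \<and> q = gtp K a M0 N)"

definition image_type ::
  "('a, 'f, 'r) abs_class \<Rightarrow> ('a \<Rightarrow> 'a) \<Rightarrow> ('a, 'f, 'r) struct \<Rightarrow> ('a, 'f, 'r) gtype \<Rightarrow>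
   ('a, 'f, 'r) gtype" where
  "image_type K f N2 p =
     (SOME q. \<exists>a N1 N N' g. (a, N1, N) \<in> p \<and> is_iso (voc K) g N N' \<and>
        (\<forall>x\<in>univ N1. g x = f x) \<and> q = gtp K (g a) N2 N')"


section \<open>Universal extensions and limit models\<close>

definition universal_over ::
  "('a, 'f, 'r) abs_class \<Rightarrow> 'i rel \<Rightarrow> ('a, 'f, 'r) struct \<Rightarrow> ('a, 'f, 'r) struct \<Rightarrow> bool" where
  "universal_over K lam M0 M \<longleftrightarrow>
     M0 \<in> models_of_card K lam \<and> M \<in> models_of_card K lam \<and> M0 \<preceq>\<^bsub>K\<^esub> M \<and>
     (\<forall>N\<in>models_of_card K lam. M0 \<preceq>\<^bsub>K\<^esub> N \<longrightarrow>
        (\<exists>h. K_embedding K h N M \<and> fixes_pointwise h M0))"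

text \<open>As \<open>\<delta>\<close> is a limit ordinal, a continuous chain \<open>\<langle>M i : i \<le> \<delta>\<rangle>\<close> is the same thing as its
  restriction to \<open>i < \<delta>\<close>, with the union as the last model.\<close>

definition limit_model ::
  "('a, 'f, 'r) abs_class \<Rightarrow> 'a rel \<Rightarrow> 'a rel \<Rightarrow> ('a, 'f, 'r) struct \<Rightarrow> bool" where
  "limit_model K lam \<delta> N \<longleftrightarrow>
     limit_ord \<delta> \<and> \<delta> <o cardSuc lam \<and>
     (\<exists>M. (\<forall>i\<in>Field \<delta>. M i \<in> models_of_card K lam) \<and>
          increasing (le K) \<delta> M \<and> continuous_chain (voc K) \<delta> M \<and>
          (\<forall>i j. is_succ_of \<delta> i j \<longrightarrow> universal_over K lam (M i) (M j)) \<and>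
          N = union_struct (voc K) (Field \<delta>) M)"

definition limit_model_ge ::
  "('a, 'f, 'r) abs_class \<Rightarrow> 'a rel \<Rightarrow> 'a rel \<Rightarrow> ('a, 'f, 'r) struct \<Rightarrow> bool" where
  "limit_model_ge K lam \<kappa> N \<longleftrightarrow>
     (\<exists>\<delta> :: 'a rel. regular \<delta> \<and> \<kappa> \<le>o \<delta> \<and> \<delta> <o cardSuc lam \<and> limit_model K lam \<delta> N)"

text \<open>\<open>\<le>\<^sup>u\<close>-increasing chains are not required to be continuous.\<close>

definition universal_chain ::
  "('a, 'f, 'r) abs_class \<Rightarrow> 'a rel \<Rightarrow> 'a rel \<Rightarrow> ('a \<Rightarrow> ('a, 'f, 'r) struct) \<Rightarrow> bool" where
  "universal_chain K lam \<gamma> M \<longleftrightarrow>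
     (\<forall>i\<in>Field \<gamma>. M i \<in> models_of_card K lam) \<and> increasing (universal_over K lam) \<gamma> M"


section \<open>Independence relations\<close>

text \<open>\<open>I M0 a M N\<close> reads: the element \<open>a\<close> of \<open>N\<close> is independent from \<open>M\<close> over \<open>M0\<close>.\<close>

type_synonym ('a, 'f, 'r) indep =
  "('a, 'f, 'r) struct \<Rightarrow> 'a \<Rightarrow> ('a, 'f, 'r) struct \<Rightarrow> ('a, 'f, 'r) struct \<Rightarrow> bool"

definition independence_relation ::
  "('a, 'f, 'r) abs_class \<Rightarrow> 'a rel \<Rightarrow> ('a, 'f, 'r) indep \<Rightarrow> bool" where
  "independence_relation K lam I \<longleftrightarrow>
     (\<forall>M0 a M N. I M0 a M N \<longrightarrow>
        M0 \<in> models_of_card K lam \<and> M \<in> models_of_card K lam \<and> N \<in> models_of_card K lam \<and>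
        M0 \<preceq>\<^bsub>K\<^esub> M \<and> M \<preceq>\<^bsub>K\<^esub> N \<and> a \<in> univ N) \<and>
     \<comment> \<open>invariance\<close>
     (\<forall>M0 a M N M0' M' N' h. I M0 a M N \<and> is_iso (voc K) h N N' \<and> is_iso (voc K) h M M' \<and>
        is_iso (voc K) h M0 M0' \<longrightarrow> I M0' (h a) M' N') \<and>
     \<comment> \<open>monotonicity\<close>
     (\<forall>M0 a M N M'. I M0 a M N \<and> M' \<in> models_of_card K lam \<and> M0 \<preceq>\<^bsub>K\<^esub> M' \<and> M' \<preceq>\<^bsub>K\<^esub> M \<longrightarrow>
        I M0 a M' N) \<and>
     (\<forall>M0 a M N N'. I M0 a M N \<and> N' \<in> models_of_card K lam \<and> M \<preceq>\<^bsub>K\<^esub> N' \<and> N' \<preceq>\<^bsub>K\<^esub> N \<and>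
        a \<in> univ N' \<longrightarrow> I M0 a M N') \<and>
     (\<forall>M0 a M N N'. I M0 a M N \<and> N' \<in> models_of_card K lam \<and> N \<preceq>\<^bsub>K\<^esub> N' \<longrightarrow> I M0 a M N') \<and>
     \<comment> \<open>base monotonicity\<close>
     (\<forall>M0 a M N M0'. I M0 a M N \<and> M0' \<in> models_of_card K lam \<and> M0 \<preceq>\<^bsub>K\<^esub> M0' \<and> M0' \<preceq>\<^bsub>K\<^esub> M \<longrightarrow>
        I M0' a M N)"

definition nonforking ::
  "('a, 'f, 'r) abs_class \<Rightarrow> ('a, 'f, 'r) indep \<Rightarrow> ('a, 'f, 'r) gtype \<Rightarrow> ('a, 'f, 'r) struct \<Rightarrow> bool" where
  "nonforking K I p M0 \<longleftrightarrow> (\<exists>a M N. p = gtp K a M N \<and> I M0 a M N)"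

definition uniqueness ::
  "('a, 'f, 'r) abs_class \<Rightarrow> 'a rel \<Rightarrow> ('a, 'f, 'r) indep \<Rightarrow> bool" where
  "uniqueness K lam I \<longleftrightarrow>
     (\<forall>M\<in>models_of_card K lam. \<forall>N\<in>models_of_card K lam. \<forall>p\<in>gS K N. \<forall>q\<in>gS K N.
        M \<preceq>\<^bsub>K\<^esub> N \<and> nonforking K I p M \<and> nonforking K I q M \<and>
        restrict_type K p M = restrict_type K q M \<longrightarrow> p = q)"

definition extension ::
  "('a, 'f, 'r) abs_class \<Rightarrow> 'a rel \<Rightarrow> ('a, 'f, 'r) indep \<Rightarrow> bool" where
  "extension K lam I \<longleftrightarrow>
     (\<forall>M0\<in>models_of_card K lam. \<forall>M\<in>models_of_card K lam. \<forall>N\<in>models_of_card K lam. \<forall>p\<in>gS K M.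
        M0 \<preceq>\<^bsub>K\<^esub> M \<and> M \<preceq>\<^bsub>K\<^esub> N \<and> nonforking K I p M0 \<longrightarrow>
        (\<exists>q\<in>gS K N. restrict_type K q M = p \<and> nonforking K I q M0))"

definition local_character ::
  "('a, 'f, 'r) abs_class \<Rightarrow> 'a rel \<Rightarrow> ('a, 'f, 'r) indep \<Rightarrow> 'a rel \<Rightarrow> bool" where
  "local_character K lam I \<gamma> \<longleftrightarrow>
     (\<forall>M. universal_chain K lam \<gamma> M \<longrightarrow>
        (\<forall>p\<in>gS K (union_struct (voc K) (Field \<gamma>) M). \<exists>i\<in>Field \<gamma>. nonforking K I p (M i)))"

text \<open>Lengths of chains are below \<open>lam\<^sup>+\<close> throughout, since otherwise the union of a
  \<open>\<le>\<^sup>u\<close>-increasing chain has more than \<open>lam\<close> elements.\<close>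

definition local_character_ge ::
  "('a, 'f, 'r) abs_class \<Rightarrow> 'a rel \<Rightarrow> ('a, 'f, 'r) indep \<Rightarrow> 'a rel \<Rightarrow> bool" where
  "local_character_ge K lam I \<kappa> \<longleftrightarrow>
     (\<forall>\<gamma> :: 'a rel. regular \<gamma> \<and> \<kappa> \<le>o \<gamma> \<and> \<gamma> <o cardSuc lam \<longrightarrow> local_character K lam I \<gamma>)"

definition universal_continuity_at ::
  "('a, 'f, 'r) abs_class \<Rightarrow> 'a rel \<Rightarrow> ('a, 'f, 'r) indep \<Rightarrow> 'a rel \<Rightarrow> bool" where
  "universal_continuity_at K lam I \<gamma> \<longleftrightarrow>
     (\<forall>M. universal_chain K lam \<gamma> M \<longrightarrow>
        (\<forall>p\<in>gS K (union_struct (voc K) (Field \<gamma>) M).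
           (\<forall>i\<in>Field \<gamma>. nonforking K I (restrict_type K p (M i)) (M (wo_rel.minim \<gamma> (Field \<gamma>)))) \<longrightarrow>
           nonforking K I p (M (wo_rel.minim \<gamma> (Field \<gamma>)))))"

definition universal_continuity ::
  "('a, 'f, 'r) abs_class \<Rightarrow> 'a rel \<Rightarrow> ('a, 'f, 'r) indep \<Rightarrow> bool" where
  "universal_continuity K lam I \<longleftrightarrow>
     (\<forall>\<gamma> :: 'a rel. regular \<gamma> \<and> \<gamma> <o cardSuc lam \<longrightarrow> universal_continuity_at K lam I \<gamma>)"

text \<open>The cardinal \<open>\<kappa>(I, K\<^sub>\<lambda>, \<le>\<^sup>u)\<close>.\<close>

definition kappa ::
  "('a, 'f, 'r) abs_class \<Rightarrow> 'a rel \<Rightarrow> ('a, 'f, 'r) indep \<Rightarrow> 'a rel" where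
  "kappa K lam I = least_card (\<lambda>\<mu>. \<mu> \<le>o lam \<and>
     (\<forall>\<delta> :: 'a rel. regular \<delta> \<and> \<mu> \<le>o \<delta> \<and> \<delta> <o cardSuc lam \<longrightarrow>
        (\<forall>M. universal_chain K lam \<delta> M \<and> continuous_chain (voc K) \<delta> M \<longrightarrow>
           (\<forall>p\<in>gS K (union_struct (voc K) (Field \<delta>) M). \<exists>i\<in>Field \<delta>. nonforking K I p (M i)))))"


section \<open>Splitting and non-forking over \<open>lam\<close>\<close>

text \<open>Below, \<open>p\<close> is a type over \<open>N\<close>.\<close>

definition splits ::
  "('a, 'f, 'r) abs_class \<Rightarrow> 'a rel \<Rightarrow> ('a, 'f, 'r) gtype \<Rightarrow> ('a, 'f, 'r) struct \<Rightarrow>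
   ('a, 'f, 'r) struct \<Rightarrow> bool" where
  "splits K lam p N M \<longleftrightarrow>
     (\<exists>N1\<in>models_of_card K lam. \<exists>N2\<in>models_of_card K lam. \<exists>f.
        M \<preceq>\<^bsub>K\<^esub> N1 \<and> N1 \<preceq>\<^bsub>K\<^esub> N \<and> M \<preceq>\<^bsub>K\<^esub> N2 \<and> N2 \<preceq>\<^bsub>K\<^esub> N \<and>
        is_iso (voc K) f N1 N2 \<and> fixes_pointwise f M \<and>
        image_type K f N2 (restrict_type K p N1) \<noteq> restrict_type K p N2)"

definition lam_nonforking ::
  "('a, 'f, 'r) abs_class \<Rightarrow> 'a rel \<Rightarrow> ('a, 'f, 'r) gtype \<Rightarrow> ('a, 'f, 'r) struct \<Rightarrow>
   ('a, 'f, 'r) struct \<Rightarrow> bool" where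
  "lam_nonforking K lam p N M \<longleftrightarrow>
     (\<exists>M0\<in>models_of_card K lam. universal_over K lam M0 M \<and> \<not> splits K lam p N M0)"

end

(*
  If p does not fork over L, then, by local character, transitivity and the presentation of L as
  the union of a chain, p does not fork over a model M_i of the chain; hence by uniqueness p does
  not split over M_i, and L is universal over M_i.

  Conversely, let L be universal over M0 and let p not split over M0.  Embedding L into a model M_j
  of the chain, undoing this embedding on an extension of M0, and returning to L over M0 gives an
  embedding e of L into itself such that e(M_j) extends M0.  By local character the restriction of
  p to e(L) does not fork over some e(M_i) above e(M_j).  Its nonforking extension q to M does not
  split over e(M_i), nor does p, and p and q agree on e(L), which is universal over e(M_i);
  so p = q.
*)
theory Submission
  imports Defs
begin

section \<open>Isomorphisms of structures\<close>

text \<open>The converse is delicate because the witness \<open>M0\<close> for not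
  \<open>lam\<close>-forking has no given relation to the chain below L: all these models have size
  \<open>lam\<close>, so \<open>M0\<close> need not lie inside any member of the chain. It cannot be
  replaced either, since p is known not to split over this particular model. Hence the chain is
  moved. Its copy ends in a model e(L) that may be a proper submodel of L, and this loss is made
  good by weak uniqueness: a type that does not split over a base is determined, among such types,
  by its restriction to a universal extension of that base. A second obstacle lies in the types.
  Their equality is a finite chain of amalgams of unrestricted size, whereas the hypotheses speak of
  models of size \<open>lam\<close>. Downward Loewenheim-Skolem and amalgamation reduce it to a
  single amalgam of size \<open>lam\<close>, and on this criterion rests the well-definedness of
  images of types.\<close>

lemma
  assumes "is_struct V M"
  shows fint_in_univ: "f \<in> funs V \<Longrightarrow> xs \<in> tuples (farity V f) (univ M) \<Longrightarrow> fint M f xs \<in> univ M"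
    and fint_undefined: "\<not> (f \<in> funs V \<and> xs \<in> tuples (farity V f) (univ M)) \<Longrightarrow> fint M f xs = undefined"
    and rint_subset: "R \<in> rels V \<Longrightarrow> rint M R \<subseteq> tuples (rarity V R) (univ M)"
    and rint_empty: "R \<notin> rels V \<Longrightarrow> rint M R = {}"
  using assms by (simp_all add: is_struct_def)

lemma is_iso_struct: "is_iso V h M N \<Longrightarrow> is_struct V M" "is_iso V h M N \<Longrightarrow> is_struct V N"
  by (simp_all add: is_iso_def)

lemma tuples_mono: "A \<subseteq> B \<Longrightarrow> tuples n A \<subseteq> tuples n B"
  by (auto simp: tuples_def)

lemma is_iso_cong:
  assumes "is_iso V h M N" and "\<And>x. x \<in> univ M \<Longrightarrow> h x = g x"
  shows "is_iso V g M N"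
proof -
  have m: "map h xs = map g xs" if "xs \<in> tuples n (univ M)" for xs n
    using that assms(2) by (auto simp: tuples_def)
  have "h (fint M f xs) = g (fint M f xs)" if "f \<in> funs V" "xs \<in> tuples (farity V f) (univ M)" for f xs
  proof -
    have "fint M f xs \<in> univ M"
      using assms(1) that is_iso_struct fint_in_univ by metis
    then show ?thesis using assms(2) by simp
  qed
  moreover have "bij_betw g (univ M) (univ N)"
    using assms bij_betw_cong[of "univ M" h g] by (auto simp: is_iso_def)
  ultimately show ?thesis
    using assms(1) m unfolding is_iso_def by metis
qed

text \<open>Invariance asks for one map that is an isomorphism on the small and on the large model.
  For a map fixing M pointwise this supplies the small one, so M stays below the image of each of
  its extensions.\<close>

lemma is_iso_fixing: "is_struct V M \<Longrightarrow> fixes_pointwise h M \<Longrightarrow> is_iso V h M M"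
  by (rule is_iso_cong[of V "\<lambda>x. x"]) (auto simp: is_iso_def fixes_pointwise_def bij_betw_def)

lemma is_iso_imageE:
  assumes "is_iso V h M N" "y \<in> univ N"
  obtains x where "x \<in> univ M" "y = h x"
  using assms unfolding is_iso_def bij_betw_def by blast

lemma is_iso_comp:
  assumes "is_iso V h M N" "is_iso V g N P"
  shows "is_iso V (g \<circ> h) M P"
proof -
  have t: "map h xs \<in> tuples n (univ N)" if "xs \<in> tuples n (univ M)" for xs n
    using that assms(1) by (auto simp: tuples_def is_iso_def bij_betw_def)
  have "bij_betw (g \<circ> h) (univ M) (univ P)"
    using assms by (auto simp: is_iso_def intro: bij_betw_trans)
  then show ?thesis
    using assms t unfolding is_iso_def by (simp flip: map_map)
qed

lemma is_iso_inv:
  assumes "is_iso V h M N"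
  shows "is_iso V (inv_into (univ M) h) N M"
proof -
  let ?g = "inv_into (univ M) h"
  have b: "bij_betw h (univ M) (univ N)" using assms by (simp add: is_iso_def)
  have g: "?g x \<in> univ M" "h (?g x) = x" if "x \<in> univ N" for x
    using that b by (auto simp: bij_betw_def inv_into_into f_inv_into_f)
  have t: "map ?g xs \<in> tuples n (univ M)" "map h (map ?g xs) = xs"
    if "xs \<in> tuples n (univ N)" for xs n
    using that g by (auto simp: tuples_def map_idI subset_iff)
  have f: "?g (fint N f xs) = fint M f (map ?g xs)"
    if "f \<in> funs V" "xs \<in> tuples (farity V f) (univ N)" for f xs
  proof -
    have "h (fint M f (map ?g xs)) = fint N f xs"
      using assms that t[OF that(2)] unfolding is_iso_def by metis
    moreover have "fint M f (map ?g xs) \<in> univ M"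
      using assms that t[OF that(2)] is_iso_struct fint_in_univ by metis
    ultimately show ?thesis
      using b by (metis bij_betw_def inv_into_f_f)
  qed
  show ?thesis
    using assms bij_betw_inv_into[OF b] f t unfolding is_iso_def by metis
qed

text \<open>Transport of structure, meant for h injective on the universe. The value
  \<open>undefined\<close> is forced by \<open>is_struct\<close>, which demands normalised
  interpretations.\<close>

definition push :: "('f, 'r) vocabulary \<Rightarrow> ('a \<Rightarrow> 'a) \<Rightarrow> ('a, 'f, 'r) struct \<Rightarrow> ('a, 'f, 'r) struct" where
  "push V h M = \<lparr>
     univ = h ` univ M,
     fint = (\<lambda>f xs. if f \<in> funs V \<and> xs \<in> tuples (farity V f) (h ` univ M)
       then h (fint M f (map (inv_into (univ M) h) xs)) else undefined),
     rint = (\<lambda>R. map h ` rint M R) \<rparr>"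

lemma is_iso_push:
  assumes "is_struct V M" "inj_on h (univ M)"
  shows "is_iso V h M (push V h M)"
proof -
  let ?g = "inv_into (univ M) h"
  have g: "?g x \<in> univ M" if "x \<in> h ` univ M" for x
    using that by (simp add: inv_into_into)
  have t: "map ?g xs \<in> tuples n (univ M)" if "xs \<in> tuples n (h ` univ M)" for xs n
    using that g by (auto simp: tuples_def)
  have t': "map h xs \<in> tuples n (h ` univ M)" "map ?g (map h xs) = xs"
    if "xs \<in> tuples n (univ M)" for xs n
    using that assms(2) by (auto simp: tuples_def map_idI subset_iff)
  note r = rint_subset[OF assms(1)] and r0 = rint_empty[OF assms(1)]
    and f = fint_in_univ[OF assms(1)]
  have "is_struct V (push V h M)"
    using assms(1) t r0 f subsetD[OF r] t'(1) unfolding is_struct_def push_def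
    by (simp add: image_subset_iff)
  \<comment> \<open>\<open>map h\<close> is injective on tuples over the universe, so the image of a
    relation pulls back to exactly that relation.\<close>
  moreover have "xs \<in> rint M R" if "xs \<in> tuples (rarity V R) (univ M)" "R \<in> rels V"
      "map h xs = map h ys" "ys \<in> rint M R" for xs ys R
    using that t'(2) r by (metis subsetD)
  ultimately show ?thesis
    using assms t' unfolding is_iso_def
    by (auto simp: push_def bij_betw_def)
qed

lemma substruct_univD: "substruct V M N \<Longrightarrow> univ M \<subseteq> univ N"
  by (simp add: substruct_def)

lemma substruct_shrink:
  assumes "substruct V M P" "substruct V N P" "univ M \<subseteq> univ N"
  shows "substruct V M N"
proof -
  have "xs \<in> tuples n (univ N)" if "xs \<in> tuples n (univ M)" for xs n
    using that tuples_mono[OF assms(3)] by blast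
  then show ?thesis
    using assms by (simp add: substruct_def)
qed

text \<open>This is where normalisation counts: off the vocabulary and off the universe both
  interpretations are forced. It makes a model with universe \<open>UNIV\<close> maximal.\<close>

lemma substruct_univ_eq:
  fixes M N :: "('a, 'f, 'r) struct"
  assumes "substruct V M N" "univ M = univ N"
  shows "M = N"
proof -
  have str: "is_struct V M" "is_struct V N" using assms by (simp_all add: substruct_def)
  have "fint M f xs = fint N f xs" for f xs
  proof (cases "f \<in> funs V \<and> xs \<in> tuples (farity V f) (univ M)")
    case True
    then show ?thesis using assms by (simp add: substruct_def)
  next
    case False
    then show ?thesis using str assms(2) fint_undefined by metis
  qed
  moreover have "rint M R = rint N R" for R
  proof (cases "R \<in> rels V")
    case True
    then have "rint M R \<subseteq> tuples (rarity V R) (univ M)" "rint N R \<subseteq> tuples (rarity V R) (univ M)"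
      using str assms(2) rint_subset by metis+
    then show ?thesis using assms True by (auto simp: substruct_def)
  next
    case False
    then show ?thesis using str by (simp add: rint_empty)
  qed
  ultimately show ?thesis using assms(2) by (simp add: fun_eq_iff)
qed


section \<open>Abstract elementary classes\<close>

text \<open>\<open>least_card\<close> is a choice and means something only once some cardinal has
  the property; cardinals being well-ordered, there is then a least one.\<close>

lemma least_card_prop:
  assumes "Card_order \<mu>" "P \<mu>"
  shows "Card_order (least_card P) \<and> P (least_card P)"
proof -
  let ?S = "{\<mu>. Card_order \<mu> \<and> P \<mu>}"
  have "\<exists>m\<in>?S. \<forall>n\<in>?S. m \<le>o n"
    using assms exists_minim_Card_order[of ?S] by blast
  then have "\<exists>\<mu>. Card_order \<mu> \<and> P \<mu> \<and> (\<forall>\<nu>. Card_order \<nu> \<and> P \<nu> \<longrightarrow> \<mu> \<le>o \<nu>)" by blast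
  from someI_ex[OF this] show ?thesis unfolding least_card_def by blast
qed

locale aec =
  fixes K :: "('a, 'f, 'r) abs_class" (structure)
  assumes AEC: "AEC K"
begin

lemmas AEC_conjuncts = AEC[unfolded AEC_def]

lemmas model_struct = AEC_conjuncts[THEN conjunct1, rule_format]

lemmas iso_model = AEC_conjuncts[THEN conjunct2, THEN conjunct1, rule_format, OF conjI]

lemma le_iso: "M \<preceq> N \<Longrightarrow> is_iso (voc K) h N N' \<Longrightarrow> is_iso (voc K) h M M' \<Longrightarrow> M' \<preceq> N'"
  by (rule AEC_conjuncts[THEN conjunct2, THEN conjunct2, THEN conjunct1, rule_format]) blast

lemma leD: assumes "M \<preceq> N"
  shows "M \<in> models K" "N \<in> models K" "substruct (voc K) M N" "univ M \<subseteq> univ N"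
  using AEC_conjuncts[THEN conjunct2, THEN conjunct2, THEN conjunct2, THEN conjunct1, rule_format, OF assms]
  by (auto dest: substruct_univD)

lemmas le_refl = AEC_conjuncts[THEN conjunct2, THEN conjunct2, THEN conjunct2, THEN conjunct2,
    THEN conjunct1, rule_format]

lemmas le_trans = AEC_conjuncts[THEN conjunct2, THEN conjunct2, THEN conjunct2, THEN conjunct2,
    THEN conjunct2, THEN conjunct1, rule_format, OF conjI]

text \<open>Inside a common extension, inclusion of universes already gives a substructure, so
  coherence can be used by comparing sets.\<close>

lemma le_shrink:
  assumes "M \<preceq> P" "N \<preceq> P" "univ M \<subseteq> univ N"
  shows "M \<preceq> N"
proof -
  have "substruct (voc K) M N"
    using assms leD(3) substruct_shrink by blast
  then show ?thesis
    using AEC_conjuncts[THEN conjunct2, THEN conjunct2, THEN conjunct2, THEN conjunct2,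
        THEN conjunct2, THEN conjunct2, THEN conjunct1, rule_format] assms by blast
qed

lemma le_union_struct:
  fixes r :: "'a rel"
  assumes "limit_ord r" "\<forall>i\<in>Field r. M i \<in> models K" "increasing (le K) r M" "i \<in> Field r"
  shows "M i \<preceq> union_struct (voc K) (Field r) M"
  using AEC_conjuncts[THEN conjunct2, THEN conjunct2, THEN conjunct2, THEN conjunct2,
      THEN conjunct2, THEN conjunct2, THEN conjunct2, THEN conjunct1, rule_format, of r M] assms
  by blast

lemma LS_bound_LS: "LS_bound K (LS K)"
proof -
  obtain \<mu> :: "('a + 'f + 'r + nat) rel" where "LS_bound K \<mu>"
    using AEC_conjuncts[THEN conjunct2, THEN conjunct2, THEN conjunct2, THEN conjunct2,
        THEN conjunct2, THEN conjunct2, THEN conjunct2, THEN conjunct2] by blast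
  then show ?thesis
    using least_card_prop[of \<mu> "LS_bound K"] unfolding LS_def by (simp add: LS_bound_def)
qed

lemma iso_submodel:
  assumes "is_iso (voc K) h N N'" "M \<preceq> N"
  obtains M' where "is_iso (voc K) h M M'" "M' \<preceq> N'" "univ M' = h ` univ M"
proof -
  have "inj_on h (univ M)"
    using assms leD(4) by (auto simp: is_iso_def bij_betw_def inj_on_subset)
  then have i: "is_iso (voc K) h M (push (voc K) h M)"
    using assms(2) leD(1) model_struct is_iso_push by blast
  then show thesis
    using that le_iso[OF assms(2,1) i] by (simp add: push_def)
qed

section \<open>Embeddings of models\<close>

lemma K_embeddingE:
  assumes "K_embedding K h M N"
  obtains M' where "is_iso (voc K) h M M'" "M' \<preceq> N" "univ M' = h ` univ M"
  using assms unfolding K_embedding_def by (auto simp: is_iso_def bij_betw_def)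

lemma K_embedding_comp:
  assumes "K_embedding K h M N" "K_embedding K g N P"
  shows "K_embedding K (g \<circ> h) M P"
proof -
  obtain M' where M': "is_iso (voc K) h M M'" "M' \<preceq> N" by (rule K_embeddingE[OF assms(1)]) blast
  obtain N' where N': "is_iso (voc K) g N N'" "N' \<preceq> P" by (rule K_embeddingE[OF assms(2)]) blast
  obtain M'' where "is_iso (voc K) g M' M''" "M'' \<preceq> N'" by (rule iso_submodel[OF N'(1) M'(2)]) blast
  then show ?thesis
    using M' N' is_iso_comp le_trans unfolding K_embedding_def by blast
qed

lemma iso_K_embedding: "is_iso (voc K) h M N \<Longrightarrow> N \<preceq> P \<Longrightarrow> K_embedding K h M P"
  unfolding K_embedding_def by blast

lemma le_K_embedding: "M \<preceq> N \<Longrightarrow> K_embedding K (\<lambda>x. x) M N"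
  by (rule iso_K_embedding[of _ _ M]) (auto intro!: is_iso_fixing model_struct leD(1) simp: fixes_pointwise_def)

lemma K_embedding_restrict: "M \<preceq> N \<Longrightarrow> K_embedding K h N P \<Longrightarrow> K_embedding K h M P"
  using K_embedding_comp[OF le_K_embedding, of M N h P] by (simp add: comp_def)

lemma K_embedding_shrink:
  assumes "K_embedding K h M P" "P0 \<preceq> P" "h ` univ M \<subseteq> univ P0"
  shows "K_embedding K h M P0"
  using assms(1) by (rule K_embeddingE) (use assms le_shrink iso_K_embedding in metis)

section \<open>Galois types and their restrictions in an arbitrary AEC\<close>

lemma atomic_equivI:
  assumes "M \<preceq> N1" "a \<in> univ N1" "M \<preceq> N2" "b \<in> univ N2" "P \<in> models K"
    "K_embedding K h1 N1 P" "fixes_pointwise h1 M"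
    "K_embedding K h2 N2 P" "fixes_pointwise h2 M" "h1 a = h2 b"
  shows "((a, M, N1), (b, M, N2)) \<in> atomic_equiv K"
  using assms unfolding atomic_equiv_def by blast

lemma atomic_equivE:
  assumes "((a, M, N1), (b, M', N2)) \<in> atomic_equiv K"
  obtains P h1 h2 where "M' = M" "M \<preceq> N1" "a \<in> univ N1" "M \<preceq> N2" "b \<in> univ N2" "P \<in> models K"
    "K_embedding K h1 N1 P" "fixes_pointwise h1 M"
    "K_embedding K h2 N2 P" "fixes_pointwise h2 M" "h1 a = h2 b"
  using assms unfolding atomic_equiv_def by blast

lemma fixes_pointwise_id: "fixes_pointwise (\<lambda>x. x) M"
  by (simp add: fixes_pointwise_def)

lemma fixes_pointwise_mono: "fixes_pointwise h N \<Longrightarrow> M \<preceq> N \<Longrightarrow> fixes_pointwise h M"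
  using leD(4) by (auto simp: fixes_pointwise_def)

text \<open>A transitive closure need not be reflexive; the identity embeddings of N into itself
  supply the missing loop.\<close>

lemma gtp_mem: "M \<preceq> N \<Longrightarrow> a \<in> univ N \<Longrightarrow> (a, M, N) \<in> gtp K a M N"
  unfolding gtp_def
  by (auto intro!: r_into_trancl atomic_equivI[of _ _ _ _ _ N "\<lambda>x. x" "\<lambda>x. x"] le_K_embedding le_refl leD(2)
      fixes_pointwise_id)

lemma sym_atomic_equiv: "sym (atomic_equiv K)"
  by (rule symI) (auto elim!: atomic_equivE intro!: atomic_equivI)

lemma gtp_memD:
  assumes "(b, M', N') \<in> gtp K a M N"
  shows "M' = M" "M \<preceq> N'" "b \<in> univ N'" "gtp K b M' N' = gtp K a M N"
proof -
  have t: "((a, M, N), (b, M', N')) \<in> (atomic_equiv K)\<^sup>+"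
    using assms by (simp add: gtp_def)
  then show "M' = M" "M \<preceq> N'" "b \<in> univ N'"
    by (induction "(b, M', N')" arbitrary: b M' N') (auto elim!: atomic_equivE)
  have s: "((b, M', N'), (a, M, N)) \<in> (atomic_equiv K)\<^sup>+"
    using t sym_trancl[OF sym_atomic_equiv] by (auto dest: symD)
  show "gtp K b M' N' = gtp K a M N"
    using s t by (auto simp: gtp_def intro: trancl_trans)
qed

lemma gtp_eqI: "((a, M, N), (b, M, N')) \<in> atomic_equiv K \<Longrightarrow> gtp K a M N = gtp K b M N'"
  using gtp_memD(4)[of b M N' a M N] by (auto simp: gtp_def)

text \<open>N' itself is the amalgam: N enters by g, and N' by the identity.\<close>

lemma gtp_iso_fixing:
  assumes "M \<preceq> N" "a \<in> univ N" "is_iso (voc K) g N N'" "fixes_pointwise g M"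
  shows "gtp K (g a) M N' = gtp K a M N"
proof -
  have N': "N' \<in> models K" using assms leD(2) iso_model by blast
  have "is_iso (voc K) g M M"
    using assms model_struct leD(1) is_iso_fixing by blast
  then have "M \<preceq> N'" using le_iso assms by blast
  moreover have "g a \<in> univ N'" using assms by (auto simp: is_iso_def bij_betw_def)
  ultimately show ?thesis
    using assms N'
    by (intro gtp_eqI[symmetric] atomic_equivI[of _ _ _ _ _ N' g "\<lambda>x. x"])
      (auto intro: iso_K_embedding le_refl le_K_embedding fixes_pointwise_id)
qed

lemma gtp_enlarge:
  assumes "M \<preceq> N" "N \<preceq> N'" "a \<in> univ N"
  shows "gtp K a M N' = gtp K a M N"
proof (rule gtp_eqI[symmetric], rule atomic_equivI)
  show "K_embedding K (\<lambda>x. x) N N'" "K_embedding K (\<lambda>x. x) N' N'"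
    using le_K_embedding le_refl leD(2) assms(2) by blast+
  show "M \<preceq> N'" using assms le_trans by blast
  show "a \<in> univ N'" using assms leD(4) by blast
qed (use assms leD(2) fixes_pointwise_id in blast)+

lemma atomic_equiv_restrict:
  assumes "((a, M, N), (b, M', N')) \<in> atomic_equiv K" "M0 \<preceq> M"
  shows "((a, M0, N), (b, M0, N')) \<in> atomic_equiv K"
  using assms(1)
  by (rule atomic_equivE, intro atomic_equivI)
    (assumption | rule le_trans[OF assms(2)] fixes_pointwise_mono[OF _ assms(2)])+

text \<open>Equality of types is a chain of atomic steps; the amalgam of each step serves over
  \<open>M0\<close> as well, so the chain restricts link by link.\<close>

lemma gtp_eq_restrict:
  assumes "gtp K a M N = gtp K b M N'" "M \<preceq> N'" "b \<in> univ N'" "M0 \<preceq> M"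
  shows "gtp K a M0 N = gtp K b M0 N'"
proof -
  have "((a, M, N), (b, M, N')) \<in> (atomic_equiv K)\<^sup>+"
    using gtp_mem[OF assms(2,3)] assms(1) by (auto simp: gtp_def)
  then have "((a, M0, N), (b, M0, N')) \<in> (atomic_equiv K)\<^sup>+"
  proof (induction "(b, M, N')" arbitrary: b N')
    case base
    then show ?case
      using assms(4) atomic_equiv_restrict by blast
  next
    case (step y)
    obtain b' M' N'' where y: "y = (b', M', N'')" by (metis prod_cases3)
    from step(2) have [simp]: "M' = M" unfolding y by (auto elim: atomic_equivE)
    have "((b', M0, N''), (b, M0, N')) \<in> atomic_equiv K"
      using atomic_equiv_restrict[of b' M' N'' b M N' M0] step(2) assms(4) y by simp
    then show ?case using step(3)[of b' N''] y by auto
  qed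
  then have "(b, M0, N') \<in> gtp K a M0 N" by (simp add: gtp_def)
  then show ?thesis using gtp_memD(4) by metis
qed

text \<open>All representatives give the same restriction, so the choice in
  \<open>restrict_type\<close> is harmless and any convenient representative may be used.\<close>

lemma restrict_type_gtp:
  assumes "M \<preceq> N" "a \<in> univ N" "M0 \<preceq> M"
  shows "restrict_type K (gtp K a M N) M0 = gtp K a M0 N"
  unfolding restrict_type_def
proof (rule some_equality)
  show "\<exists>b M' N'. (b, M', N') \<in> gtp K a M N \<and> gtp K a M0 N = gtp K b M0 N'"
    using gtp_mem[OF assms(1,2)] by blast
next
  fix q assume "\<exists>b M' N'. (b, M', N') \<in> gtp K a M N \<and> q = gtp K b M0 N'"
  then obtain b M' N' where *: "(b, M', N') \<in> gtp K a M N" "q = gtp K b M0 N'" by blast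
  then show "q = gtp K a M0 N"
    using gtp_memD[OF *(1)] gtp_eq_restrict[of b M N' a N M0] assms by simp
qed

lemma gSE:
  assumes "p \<in> gS K M"
  obtains a N where "p = gtp K a M N" "M \<preceq> N" "a \<in> univ N"
  using assms unfolding gS_def by blast

lemma gtp_in_gS: "M \<preceq> N \<Longrightarrow> a \<in> univ N \<Longrightarrow> gtp K a M N \<in> gS K M"
  unfolding gS_def by blast

lemma restrict_type_in_gS:
  assumes "p \<in> gS K M" "M0 \<preceq> M"
  shows "restrict_type K p M0 \<in> gS K M0"
  using assms(1) by (rule gSE) (use assms(2) restrict_type_gtp gtp_in_gS le_trans in metis)

lemma restrict_type_restrict_type:
  assumes "p \<in> gS K M" "M1 \<preceq> M" "M0 \<preceq> M1"
  shows "restrict_type K (restrict_type K p M1) M0 = restrict_type K p M0"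
  using assms(1) by (rule gSE) (use assms(2,3) restrict_type_gtp le_trans in metis)

lemma restrict_type_self: "p \<in> gS K M \<Longrightarrow> restrict_type K p M = p"
  by (erule gSE) (use restrict_type_gtp leD(1) le_refl in metis)

end


text \<open>Copies of models need fresh elements of the type (see \<open>iso_extend\<close>). With
  at most \<open>lam\<close> elements in all, M could be spread over the whole of
  \<open>UNIV\<close>, and that copy would have no proper extension.\<close>

lemma universe_larger:
  fixes K :: "('a, 'f, 'r) abs_class" and lam :: "'a rel"
  assumes "AEC K" "no_maximal_models K lam" "M \<in> models_of_card K lam"
  shows "lam <o |UNIV :: 'a set|"
proof (rule ccontr)
  interpret aec K by standard fact
  have M: "M \<in> models K" "|univ M| =o lam" using assms(3) by (auto simp: models_of_card_def)
  then have w: "Well_order lam" by (auto simp: ordIso_def)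
  assume "\<not> lam <o |UNIV :: 'a set|"
  then have "|UNIV :: 'a set| \<le>o lam"
    using w not_ordLess_iff_ordLeq card_of_Well_order by blast
  then have "|UNIV :: 'a set| \<le>o |univ M|"
    using M(2) ordIso_symmetric ordLeq_ordIso_trans by blast
  moreover have "|univ M| \<le>o |UNIV :: 'a set|" by (rule card_of_mono1) simp
  ultimately have "|univ M| =o |UNIV :: 'a set|" by (simp add: ordIso_iff_ordLeq)
  then obtain h where h: "bij_betw h (univ M) (UNIV :: 'a set)"
    using card_of_ordIso by blast
  let ?M = "push (voc K) h M"
  have u: "univ ?M = UNIV" using h by (simp add: push_def bij_betw_def)
  have "is_iso (voc K) h M ?M"
    using h M(1) model_struct is_iso_push by (auto simp: bij_betw_def)
  then have "?M \<in> models K" using M(1) iso_model by blast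
  moreover have "|univ ?M| =o lam"
    using u \<open>|univ M| =o |UNIV :: 'a set|\<close> M(2) ordIso_symmetric ordIso_transitive by metis
  ultimately obtain N where N: "?M \<preceq>\<^bsub>K\<^esub> N" "N \<noteq> ?M"
    using assms(2) unfolding no_maximal_models_def models_of_card_def by blast
  then have "univ ?M = univ N" using leD(4) u by blast
  then show False using N leD(3) substruct_univ_eq by metis
qed

section \<open>Models of size \<open>lam\<close>: submodels, copies and amalgams\<close>

locale aec_card = aec K for K :: "('a, 'f, 'r) abs_class" (structure) +
  fixes lam :: "'a rel"
  assumes card: "Card_order lam"
    and LS_le: "LS K \<le>o lam"
    and amalg: "amalgamation K lam"
    and room: "lam <o |UNIV :: 'a set|"
begin

abbreviation Kl :: "('a, 'f, 'r) struct set" where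
  "Kl \<equiv> models_of_card K lam"

lemma Cinfinite_lam: "Cinfinite lam"
proof -
  have "Cinfinite (LS K)" using LS_bound_LS by (simp add: LS_bound_def)
  then show ?thesis using LS_le card cinfinite_mono by blast
qed

lemma Un_card_le: "|A| \<le>o lam \<Longrightarrow> |B| \<le>o lam \<Longrightarrow> |A \<union> B| \<le>o lam"
  using Cinfinite_lam by (auto intro!: card_of_Un_ordLeq_infinite_Field simp: cinfinite_def)

lemma singleton_card_le: "|{a :: 'a}| \<le>o lam"
proof (rule card_of_singl_ordLeq[of "Field lam" a, THEN ordLeq_ordIso_trans])
  show "Field lam \<noteq> {}" using Cinfinite_lam by (auto simp: cinfinite_def)
  show "|Field lam| =o lam" by (rule card_of_Field_ordIso[OF card])
qed

lemma KlD: "M \<in> Kl \<Longrightarrow> M \<in> models K" "M \<in> Kl \<Longrightarrow> |univ M| =o lam"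
  by (simp_all add: models_of_card_def)

lemma Kl_card_le: "M \<in> Kl \<Longrightarrow> |univ M| \<le>o lam"
  using KlD(2) ordIso_iff_ordLeq by blast

lemma iso_Kl:
  assumes "M \<in> Kl" "is_iso (voc K) h M N"
  shows "N \<in> Kl"
proof -
  have "|univ M| =o |univ N|" using assms(2) by (auto simp: is_iso_def intro: card_of_ordIsoI)
  then show ?thesis
    using assms KlD iso_model ordIso_symmetric ordIso_transitive unfolding models_of_card_def by blast
qed

text \<open>Downward Loewenheim-Skolem for \<open>A \<union> univ M\<close>: including M keeps the
  size from falling below \<open>lam\<close>, and coherence then puts M below
  \<open>N0\<close>.\<close>

lemma small_submodel:
  assumes "M \<in> Kl" "M \<preceq> N" "A \<subseteq> univ N" "|A| \<le>o lam"
  obtains N0 where "N0 \<in> Kl" "M \<preceq> N0" "N0 \<preceq> N" "A \<subseteq> univ N0"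
proof -
  have "\<exists>N0. N0 \<preceq> N \<and> A \<union> univ M \<subseteq> univ N0 \<and> |univ N0| \<le>o |A \<union> univ M| +c LS K"
    using LS_bound_LS assms leD(2,4) unfolding LS_bound_def by (metis Un_least)
  then obtain N0 where N0: "N0 \<preceq> N" "A \<union> univ M \<subseteq> univ N0"
    "|univ N0| \<le>o |A \<union> univ M| +c LS K" by blast
  have "|A \<union> univ M| +c LS K \<le>o lam"
    using Un_card_le assms(1,4) Kl_card_le LS_le Cinfinite_lam LS_bound_LS
    by (intro csum_cinfinite_bound) (auto simp: LS_bound_def card_of_Card_order)
  then have "|univ N0| \<le>o lam" using N0(3) ordLeq_transitive by blast
  moreover have "lam \<le>o |univ N0|"
    using KlD(2)[OF assms(1)] card_of_mono1[of "univ M" "univ N0"] N0(2)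
    by (meson Un_subset_iff ordIso_ordLeq_trans ordIso_symmetric)
  ultimately have "N0 \<in> Kl"
    using N0(1) leD(1) by (simp add: models_of_card_def ordIso_iff_ordLeq)
  moreover have "M \<preceq> N0" using le_shrink[OF assms(2) N0(1)] N0(2) by blast
  ultimately show thesis using that N0 by blast
qed

text \<open>The elements of N outside M are sent injectively outside M'. There is room, for M' has
  size \<open>lam\<close> and the type has more elements. This is the formal counterpart of
  replacing N by a copy above M'.\<close>

lemma iso_extend:
  assumes f: "is_iso (voc K) f M M'" and le: "M \<preceq> N" and N: "N \<in> Kl" and M: "M \<in> Kl"
  obtains g N' where "is_iso (voc K) g N N'" "\<And>x. x \<in> univ M \<Longrightarrow> g x = f x"
    "is_iso (voc K) g M M'" "M' \<preceq> N'" "N' \<in> Kl"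
proof -
  have M': "M' \<in> Kl" using iso_Kl M f by blast
  have "|univ N - univ M| \<le>o |UNIV - univ M'|"
  proof (rule ccontr)
    assume "\<not> ?thesis"
    then have "|UNIV - univ M'| \<le>o |univ N - univ M|"
      using ordLeq_total[OF card_of_Well_order card_of_Well_order] by blast
    also have "|univ N - univ M| \<le>o |univ N|" by (rule card_of_mono1) blast
    also have "|univ N| \<le>o lam" using N Kl_card_le by blast
    finally have "|(UNIV - univ M') \<union> univ M'| \<le>o lam"
      using Un_card_le M' Kl_card_le by blast
    then have "|UNIV :: 'a set| \<le>o lam" by simp
    then show False using room not_ordLess_ordLeq by blast
  qed
  then have "\<exists>j. inj_on j (univ N - univ M) \<and> j ` (univ N - univ M) \<subseteq> UNIV - univ M'"
    by (rule card_of_ordLeq[THEN iffD2])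
  then obtain j where j: "inj_on j (univ N - univ M)" "j ` (univ N - univ M) \<subseteq> UNIV - univ M'"
    by (elim exE conjE)
  define g where "g x = (if x \<in> univ M then f x else j x)" for x
  have fM: "inj_on f (univ M)" "f ` univ M = univ M'" using f by (auto simp: is_iso_def bij_betw_def)
  have "f x \<noteq> j y" if "x \<in> univ M" "y \<in> univ N - univ M" for x y
    using fM(2) j(2) that by blast
  then have "inj_on g (univ N)"
    using inj_onD[OF fM(1)] inj_onD[OF j(1)] unfolding inj_on_def g_def
    by (metis Diff_iff)
  then have i: "is_iso (voc K) g N (push (voc K) g N)"
    using N KlD(1) model_struct is_iso_push by blast
  have gM: "is_iso (voc K) g M M'" by (rule is_iso_cong[OF f]) (simp add: g_def)
  show thesis
    by (rule that[OF i _ gM le_iso[OF le i gM] iso_Kl[OF N i]]) (simp add: g_def)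
qed

text \<open>The amalgamation property is stated for inclusions. The isomorphism between the two
  images of \<open>M0\<close> extends to a copy of \<open>M1\<close> above the image in
  \<open>M2\<close>, and the property applies to this copy and \<open>M2\<close>.\<close>

lemma amalgamate_over:
  assumes M0: "M0 \<in> Kl" and M1: "M1 \<in> Kl" and M2: "M2 \<in> Kl"
    and h: "K_embedding K h M0 M1" and f: "K_embedding K f M0 M2"
  obtains P k1 k2 where "P \<in> Kl" "K_embedding K k1 M1 P" "K_embedding K k2 M2 P"
    "\<And>x. x \<in> univ M0 \<Longrightarrow> k1 (h x) = k2 (f x)"
proof -
  obtain A where A: "is_iso (voc K) h M0 A" "A \<preceq> M1" using h by (rule K_embeddingE) blast
  obtain B where B: "is_iso (voc K) f M0 B" "B \<preceq> M2" using f by (rule K_embeddingE) blast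
  let ?h = "inv_into (univ M0) h"
  have AB: "is_iso (voc K) (f \<circ> ?h) A B" using A B is_iso_comp is_iso_inv by blast
  have "A \<in> Kl" "B \<in> Kl" using A B M0 iso_Kl by blast+
  obtain g N where g: "is_iso (voc K) g M1 N" "\<And>x. x \<in> univ A \<Longrightarrow> g x = (f \<circ> ?h) x"
    "B \<preceq> N" "N \<in> Kl"
    by (rule iso_extend[OF AB A(2) M1 \<open>A \<in> Kl\<close>]) blast
  obtain P k1 k2 where P: "P \<in> Kl" "K_embedding K k1 N P" "fixes_pointwise k1 B"
    "K_embedding K k2 M2 P" "fixes_pointwise k2 B"
    using amalg \<open>B \<in> Kl\<close> g(3,4) M2 B(2) unfolding amalgamation_def by blast
  show thesis
  proof (rule that[OF P(1) _ P(4)])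
    have "N \<preceq> N" using g(4) KlD le_refl by blast
    then show "K_embedding K (k1 \<circ> g) M1 P"
      using K_embedding_comp iso_K_embedding g(1) P(2) by blast
    fix x assume x: "x \<in> univ M0"
    have "h x \<in> univ A" "f x \<in> univ B" "?h (h x) = x"
      using A(1) B(1) x by (auto simp: is_iso_def bij_betw_def)
    then show "(k1 \<circ> g) (h x) = k2 (f x)"
      using g(2) P(3,5) by (simp add: fixes_pointwise_def)
  qed
qed


section \<open>Galois types over models of the fixed cardinality\<close>

text \<open>The embeddings only need to agree on \<open>M\<close>, not to fix it; this makes the relation invariant
  under isomorphisms.\<close>

definition jointly_embed :: "('a, 'f, 'r) struct \<Rightarrow> 'a \<Rightarrow> ('a, 'f, 'r) struct \<Rightarrow> 'a \<Rightarrow>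
    ('a, 'f, 'r) struct \<Rightarrow> bool" where
  "jointly_embed M a N b N' \<longleftrightarrow> (\<exists>P\<in>Kl. \<exists>h1 h2. K_embedding K h1 N P \<and> K_embedding K h2 N' P \<and>
     (\<forall>x\<in>univ M. h1 x = h2 x) \<and> h1 a = h2 b)"

lemma jointly_embedI:
  "P \<in> Kl \<Longrightarrow> K_embedding K h1 N P \<Longrightarrow> K_embedding K h2 N' P \<Longrightarrow>
    (\<And>x. x \<in> univ M \<Longrightarrow> h1 x = h2 x) \<Longrightarrow> h1 a = h2 b \<Longrightarrow> jointly_embed M a N b N'"
  unfolding jointly_embed_def by blast

lemma jointly_embedE:
  assumes "jointly_embed M a N b N'"
  obtains P h1 h2 where "P \<in> Kl" "K_embedding K h1 N P" "K_embedding K h2 N' P"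
    "\<And>x. x \<in> univ M \<Longrightarrow> h1 x = h2 x" "h1 a = h2 b"
  using assms unfolding jointly_embed_def by blast

text \<open>The middle model N' embeds in both amalgams, which are therefore amalgamated over it.
  This is what collapses the transitive closure to one step.\<close>

lemma jointly_embed_trans:
  assumes "jointly_embed M a N b N'" "jointly_embed M b N' c N''"
    and "N' \<in> Kl" "univ M \<subseteq> univ N'" "b \<in> univ N'"
  shows "jointly_embed M a N c N''"
proof -
  obtain P h1 h2 where P: "P \<in> Kl" "K_embedding K h1 N P" "K_embedding K h2 N' P"
    "\<And>x. x \<in> univ M \<Longrightarrow> h1 x = h2 x" "h1 a = h2 b" by (rule jointly_embedE[OF assms(1)]) blast
  obtain Q g1 g2 where Q: "Q \<in> Kl" "K_embedding K g1 N' Q" "K_embedding K g2 N'' Q"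
    "\<And>x. x \<in> univ M \<Longrightarrow> g1 x = g2 x" "g1 b = g2 c" by (rule jointly_embedE[OF assms(2)]) blast
  obtain R k1 k2 where R: "R \<in> Kl" "K_embedding K k1 P R" "K_embedding K k2 Q R"
    "\<And>x. x \<in> univ N' \<Longrightarrow> k1 (h2 x) = k2 (g1 x)"
    by (rule amalgamate_over[OF assms(3) P(1) Q(1) P(3) Q(2)]) blast
  show ?thesis
    by (rule jointly_embedI[OF R(1), of "k1 \<circ> h1" _ "k2 \<circ> g2"])
      (use P Q R K_embedding_comp assms(4,5) in auto)
qed

text \<open>An atomic step may use models and an amalgam of any size; a submodel of the amalgam of
  size \<open>lam\<close> around the two small images suffices.\<close>

lemma atomic_jointly_embed:
  assumes "((a, M, N), (b, M, N')) \<in> atomic_equiv K" "M \<in> Kl"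
    and "N0 \<in> Kl" "M \<preceq> N0" "N0 \<preceq> N" and "N0' \<in> Kl" "M \<preceq> N0'" "N0' \<preceq> N'"
  shows "jointly_embed M a N0 b N0'"
  using assms(1)
proof (rule atomic_equivE)
  fix P h1 h2
  assume P: "K_embedding K h1 N P" "fixes_pointwise h1 M"
    "K_embedding K h2 N' P" "fixes_pointwise h2 M" "h1 a = h2 b"
  have e: "K_embedding K h1 N0 P" "K_embedding K h2 N0' P"
    using K_embedding_restrict assms P by blast+
  obtain A where A: "is_iso (voc K) h1 N0 A" "A \<preceq> P" "univ A = h1 ` univ N0"
    using e(1) by (rule K_embeddingE) blast
  obtain B where B: "is_iso (voc K) h2 N0' B" "B \<preceq> P" "univ B = h2 ` univ N0'"
    using e(2) by (rule K_embeddingE) blast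
  have AB: "A \<in> Kl" "B \<in> Kl" using A B iso_Kl assms by blast+
  obtain P0 where P0: "P0 \<in> Kl" "A \<preceq> P0" "P0 \<preceq> P" "univ B \<subseteq> univ P0"
    by (rule small_submodel[OF AB(1) A(2) leD(4)[OF B(2)] Kl_card_le[OF AB(2)]]) blast
  show ?thesis
  proof (rule jointly_embedI[OF P0(1)])
    show "K_embedding K h1 N0 P0" using A P0 iso_K_embedding by blast
    show "K_embedding K h2 N0' P0" using K_embedding_shrink[OF e(2) P0(3)] P0(4) B(3) by simp
  qed (use P in \<open>auto simp: fixes_pointwise_def\<close>)
qed

lemma trancl_jointly_embed:
  assumes "((a, M, N), (b, M, N')) \<in> (atomic_equiv K)\<^sup>+" "M \<in> Kl"
    and "N0 \<in> Kl" "M \<preceq> N0" "N0 \<preceq> N" and "N0' \<in> Kl" "M \<preceq> N0'" "N0' \<preceq> N'"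
  shows "jointly_embed M a N0 b N0'"
  using assms(1,6-8)
proof (induction "(b, M, N')" arbitrary: b N' N0')
  case base
  then show ?case using atomic_jointly_embed assms by blast
next
  case (step y)
  obtain c M' N1 where y: "y = (c, M', N1)" by (metis prod_cases3)
  from step(2) have [simp]: "M' = M" and c: "M \<preceq> N1" "c \<in> univ N1"
    unfolding y by (auto elim: atomic_equivE)
  \<comment> \<open>The intermediate model may be large, so it is cut down to size
    \<open>lam\<close> around M and c before transitivity is applied.\<close>
  obtain N2 where N2: "N2 \<in> Kl" "M \<preceq> N2" "N2 \<preceq> N1" "{c} \<subseteq> univ N2"
    by (rule small_submodel[OF assms(2) c(1) _ singleton_card_le]) (use c in auto)
  have "jointly_embed M a N0 c N2" using step(3)[of c N1 N2] y N2 by simp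
  moreover have "jointly_embed M c N2 b N0'"
    using atomic_jointly_embed[of c M N1 b N' N2 N0'] step(2,4-6) y N2 assms(2) by simp
  ultimately show ?case
    using jointly_embed_trans N2 leD(4) by blast
qed

lemma gtp_eq_iff:
  assumes M: "M \<in> Kl" and N: "N \<in> Kl" "M \<preceq> N" "a \<in> univ N" and N': "N' \<in> Kl" "M \<preceq> N'" "b \<in> univ N'"
  shows "gtp K a M N = gtp K b M N' \<longleftrightarrow> jointly_embed M a N b N'"
proof
  assume "gtp K a M N = gtp K b M N'"
  then have "((a, M, N), (b, M, N')) \<in> (atomic_equiv K)\<^sup>+"
    using gtp_mem[OF N'(2,3)] by (auto simp: gtp_def)
  then show "jointly_embed M a N b N'"
    using trancl_jointly_embed assms KlD(1) le_refl by blast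
next
  assume "jointly_embed M a N b N'"
  then obtain P h1 h2 where P: "P \<in> Kl" "K_embedding K h1 N P" "K_embedding K h2 N' P"
    "\<And>x. x \<in> univ M \<Longrightarrow> h1 x = h2 x" "h1 a = h2 b" by (rule jointly_embedE) blast
  obtain A where A: "is_iso (voc K) h1 M A" "A \<preceq> P"
    by (rule K_embeddingE[OF K_embedding_restrict[OF N(2) P(2)]]) blast
  have "A \<in> Kl" using A M iso_Kl by blast
  \<comment> \<open>\<open>atomic_equiv\<close> wants maps fixing M. As \<open>h1\<close> and
    \<open>h2\<close> agree on M, composing both with an extension of the inverse of
    \<open>h1\<close> on M corrects them at once.\<close>
  obtain g P' where g: "is_iso (voc K) g P P'" "\<And>x. x \<in> univ A \<Longrightarrow> g x = inv_into (univ M) h1 x"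
    "P' \<in> Kl"
    by (rule iso_extend[OF is_iso_inv[OF A(1)] A(2) P(1) \<open>A \<in> Kl\<close>]) blast
  have gh: "g (h1 x) = x" if "x \<in> univ M" for x
    using g(2)[of "h1 x"] A(1) that by (auto simp: is_iso_def bij_betw_def)
  have "K_embedding K g P P'" using g KlD(1) le_refl iso_K_embedding by blast
  then have "K_embedding K (g \<circ> h1) N P'" "K_embedding K (g \<circ> h2) N' P'"
    using K_embedding_comp P(2,3) by blast+
  then have "((a, M, N), (b, M, N')) \<in> atomic_equiv K"
    using assms P(4,5) g(3) KlD(1) gh
    by (intro atomic_equivI[of _ _ _ _ _ P' "g \<circ> h1" "g \<circ> h2"]) (auto simp: fixes_pointwise_def)
  then show "gtp K a M N = gtp K b M N'" by (rule gtp_eqI)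
qed

section \<open>Images of types under isomorphisms\<close>

lemma gtp_iso_Kl:
  assumes M: "M \<in> Kl" and N1: "N1 \<in> Kl" "M \<preceq> N1" "a \<in> univ N1"
    and N2: "N2 \<in> Kl" "M \<preceq> N2" "b \<in> univ N2"
    and eq: "gtp K a M N1 = gtp K b M N2"
    and g1: "is_iso (voc K) g1 N1 N1'" and g2: "is_iso (voc K) g2 N2 N2'"
    and f: "is_iso (voc K) f M M'"
    and g1f: "\<And>x. x \<in> univ M \<Longrightarrow> g1 x = f x" and g2f: "\<And>x. x \<in> univ M \<Longrightarrow> g2 x = f x"
  shows "gtp K (g1 a) M' N1' = gtp K (g2 b) M' N2'"
proof -
  have i1: "is_iso (voc K) g1 M M'" and i2: "is_iso (voc K) g2 M M'"
    using f is_iso_cong g1f g2f by metis+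
  have M': "M' \<in> Kl" "N1' \<in> Kl" "N2' \<in> Kl" "M' \<preceq> N1'" "M' \<preceq> N2'"
    using iso_Kl le_iso M N1 N2 f g1 g2 i1 i2 by blast+
  have ab: "g1 a \<in> univ N1'" "g2 b \<in> univ N2'"
    using g1 g2 N1 N2 by (auto simp: is_iso_def bij_betw_def)
  obtain P h1 h2 where P: "P \<in> Kl" "K_embedding K h1 N1 P" "K_embedding K h2 N2 P"
    "\<And>x. x \<in> univ M \<Longrightarrow> h1 x = h2 x" "h1 a = h2 b"
    using eq gtp_eq_iff[OF M N1 N2] by (auto elim: jointly_embedE)
  \<comment> \<open>The amalgam P stays; the maps into it are precomposed with the inverses of
    \<open>g1\<close> and \<open>g2\<close>. They then agree on M' without fixing it, which is all
    that \<open>jointly_embed\<close> asks.\<close>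
  let ?i1 = "inv_into (univ N1) g1" and ?i2 = "inv_into (univ N2) g2"
  have inv: "?i1 (g1 x) = x" if "x \<in> univ N1" for x
    using that g1 by (auto simp: is_iso_def bij_betw_def)
  have inv2: "?i2 (g2 x) = x" if "x \<in> univ N2" for x
    using that g2 by (auto simp: is_iso_def bij_betw_def)
  have "jointly_embed M' (g1 a) N1' (g2 b) N2'"
  proof (rule jointly_embedI[OF P(1)])
    have "K_embedding K ?i1 N1' N1" "K_embedding K ?i2 N2' N2"
      using g1 g2 is_iso_inv iso_K_embedding le_refl KlD(1) N1(1) N2(1) by blast+
    then show "K_embedding K (h1 \<circ> ?i1) N1' P" "K_embedding K (h2 \<circ> ?i2) N2' P"
      using P(2,3) K_embedding_comp by blast+
    show "(h1 \<circ> ?i1) (g1 a) = (h2 \<circ> ?i2) (g2 b)" using inv inv2 N1 N2 P(5) by simp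
    fix y assume "y \<in> univ M'"
    then obtain x where x: "x \<in> univ M" "y = f x"
      by (rule is_iso_imageE[OF f])
    then have "x \<in> univ N1" "x \<in> univ N2" using leD(4) N1(2) N2(2) by blast+
    then show "(h1 \<circ> ?i1) y = (h2 \<circ> ?i2) y"
      using inv[of x] inv2[of x] x g1f[of x] g2f[of x] P(4) by simp
  qed
  then show ?thesis using gtp_eq_iff M' ab by blast
qed

lemma gtp_small:
  assumes "M \<in> Kl" "M \<preceq> N" "a \<in> univ N"
  obtains N0 where "N0 \<in> Kl" "M \<preceq> N0" "N0 \<preceq> N" "a \<in> univ N0" "gtp K a M N0 = gtp K a M N"
proof -
  obtain N0 where "N0 \<in> Kl" "M \<preceq> N0" "N0 \<preceq> N" "{a} \<subseteq> univ N0"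
    by (rule small_submodel[OF assms(1,2) _ singleton_card_le]) (use assms in auto)
  then show thesis using that gtp_enlarge[of M N0 N a] by simp
qed

text \<open>The choice in \<open>image_type\<close> ranges over representatives in models of any
  size; passing to submodels of size \<open>lam\<close> around M and the element changes no
  type.\<close>

lemma gtp_iso:
  assumes M: "M \<in> Kl" and N1: "M \<preceq> N1" "a \<in> univ N1" and N2: "M \<preceq> N2" "b \<in> univ N2"
    and eq: "gtp K a M N1 = gtp K b M N2"
    and g1: "is_iso (voc K) g1 N1 N1'" and g2: "is_iso (voc K) g2 N2 N2'"
    and f: "is_iso (voc K) f M M'"
    and g1f: "\<And>x. x \<in> univ M \<Longrightarrow> g1 x = f x" and g2f: "\<And>x. x \<in> univ M \<Longrightarrow> g2 x = f x"
  shows "gtp K (g1 a) M' N1' = gtp K (g2 b) M' N2'"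
proof -
  obtain A where A: "A \<in> Kl" "M \<preceq> A" "A \<preceq> N1" "a \<in> univ A" "gtp K a M A = gtp K a M N1"
    by (rule gtp_small[OF M N1]) blast
  obtain B where B: "B \<in> Kl" "M \<preceq> B" "B \<preceq> N2" "b \<in> univ B" "gtp K b M B = gtp K b M N2"
    by (rule gtp_small[OF M N2]) blast
  obtain A' where A': "is_iso (voc K) g1 A A'" "A' \<preceq> N1'" by (rule iso_submodel[OF g1 A(3)]) blast
  obtain B' where B': "is_iso (voc K) g2 B B'" "B' \<preceq> N2'" by (rule iso_submodel[OF g2 B(3)]) blast
  have i1: "is_iso (voc K) g1 M M'" and i2: "is_iso (voc K) g2 M M'"
    using f is_iso_cong g1f g2f by metis+
  have "M' \<preceq> A'" "M' \<preceq> B'" using le_iso A B A' B' i1 i2 by blast+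
  moreover have "g1 a \<in> univ A'" "g2 b \<in> univ B'"
    using A' B' A B by (auto simp: is_iso_def bij_betw_def)
  moreover have "gtp K (g1 a) M' A' = gtp K (g2 b) M' B'"
    using gtp_iso_Kl[OF M A(1,2,4) B(1,2,4) _ A'(1) B'(1) f g1f g2f] A(5) B(5) eq by simp
  ultimately show ?thesis using gtp_enlarge A'(2) B'(2) by metis
qed

lemma image_type_gtp:
  assumes M: "M \<in> Kl" and N: "M \<preceq> N" "a \<in> univ N"
    and g: "is_iso (voc K) g N N'" and f: "is_iso (voc K) f M M'"
    and gf: "\<And>x. x \<in> univ M \<Longrightarrow> g x = f x"
  shows "image_type K f M' (gtp K a M N) = gtp K (g a) M' N'"
  unfolding image_type_def
proof (rule some_equality)
  show "\<exists>b N1 P P' k. (b, N1, P) \<in> gtp K a M N \<and> is_iso (voc K) k P P' \<and>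
      (\<forall>x\<in>univ N1. k x = f x) \<and> gtp K (g a) M' N' = gtp K (k b) M' P'"
    using gtp_mem[OF N] g gf by blast
next
  fix q assume "\<exists>b N1 P P' k. (b, N1, P) \<in> gtp K a M N \<and> is_iso (voc K) k P P' \<and>
      (\<forall>x\<in>univ N1. k x = f x) \<and> q = gtp K (k b) M' P'"
  then obtain b N1 P P' k where *: "(b, N1, P) \<in> gtp K a M N" "is_iso (voc K) k P P'"
    "\<forall>x\<in>univ N1. k x = f x" "q = gtp K (k b) M' P'" by blast
  note b = gtp_memD[OF *(1)]
  show "q = gtp K (g a) M' N'"
    using gtp_iso[OF M b(2,3) N _ *(2) g f _ gf] b *(3,4) by simp
qed

lemma gSE_small:
  assumes "p \<in> gS K M" "M \<in> Kl"
  obtains a N where "p = gtp K a M N" "M \<preceq> N" "a \<in> univ N" "N \<in> Kl"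
  using assms(1) by (rule gSE) (use gtp_small assms(2) in metis)

text \<open>The inverses of two extensions of f both extend the inverse of f, so
  \<open>gtp_iso\<close> applied to them carries an equality of images back.\<close>

lemma image_type_inj:
  assumes p: "p \<in> gS K M" and q: "q \<in> gS K M" and M: "M \<in> Kl" and f: "is_iso (voc K) f M M'"
    and eq: "image_type K f M' p = image_type K f M' q"
  shows "p = q"
proof -
  obtain a N where a: "p = gtp K a M N" "M \<preceq> N" "a \<in> univ N" "N \<in> Kl" by (rule gSE_small[OF p M]) blast
  obtain b P where b: "q = gtp K b M P" "M \<preceq> P" "b \<in> univ P" "P \<in> Kl" by (rule gSE_small[OF q M]) blast
  obtain g N' where g: "is_iso (voc K) g N N'" "\<And>x. x \<in> univ M \<Longrightarrow> g x = f x"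
    "M' \<preceq> N'" by (rule iso_extend[OF f a(2,4) M]) blast
  obtain k P' where k: "is_iso (voc K) k P P'" "\<And>x. x \<in> univ M \<Longrightarrow> k x = f x"
    "M' \<preceq> P'" by (rule iso_extend[OF f b(2,4) M]) blast
  have e: "gtp K (g a) M' N' = gtp K (k b) M' P'"
    using eq image_type_gtp[OF M a(2,3) g(1) f g(2)] image_type_gtp[OF M b(2,3) k(1) f k(2)] a(1) b(1)
    by simp
  let ?f = "inv_into (univ M) f" and ?g = "inv_into (univ N) g" and ?k = "inv_into (univ P) k"
  have M': "M' \<in> Kl" using f M iso_Kl by blast
  have ab: "g a \<in> univ N'" "k b \<in> univ P'" "?g (g a) = a" "?k (k b) = b"
    using g k a b by (auto simp: is_iso_def bij_betw_def)
  have *: "?g y = ?f y" "?k y = ?f y" if "y \<in> univ M'" for y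
  proof -
    obtain x where x: "x \<in> univ M" "y = f x"
      by (rule is_iso_imageE[OF f \<open>y \<in> univ M'\<close>])
    then have "x \<in> univ N" "x \<in> univ P" using a(2) b(2) leD(4) by blast+
    then have "?g (g x) = x" "?k (k x) = x" "?f (f x) = x"
      using g(1) k(1) f x by (auto simp: is_iso_def bij_betw_def)
    then show "?g y = ?f y" "?k y = ?f y" using x g(2) k(2) by auto
  qed
  show ?thesis
    using gtp_iso[OF M' g(3) ab(1) k(3) ab(2) e is_iso_inv[OF g(1)] is_iso_inv[OF k(1)] is_iso_inv[OF f] *]
      ab(3,4) a(1) b(1) by simp
qed

lemma image_type_in_gS:
  assumes p: "p \<in> gS K M" and M: "M \<in> Kl" and f: "is_iso (voc K) f M M'"
  shows "image_type K f M' p \<in> gS K M'"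
proof -
  obtain a N where a: "p = gtp K a M N" "M \<preceq> N" "a \<in> univ N" "N \<in> Kl" by (rule gSE_small[OF p M]) blast
  obtain g N' where g: "is_iso (voc K) g N N'" "\<And>x. x \<in> univ M \<Longrightarrow> g x = f x"
    "M' \<preceq> N'" by (rule iso_extend[OF f a(2,4) M]) blast
  have "g a \<in> univ N'" using g(1) a(3) by (auto simp: is_iso_def bij_betw_def)
  then show ?thesis
    using image_type_gtp[OF M a(2,3) g(1) f g(2)] a(1) gtp_in_gS[OF g(3)] by simp
qed

text \<open>The preimage is the image of p under the inverse of f. It serves to pull a type over a
  copy of L back to L, where local character is available.\<close>

lemma image_type_surj:
  assumes p: "p \<in> gS K M'" and M: "M \<in> Kl" and f: "is_iso (voc K) f M M'"
  obtains r where "r \<in> gS K M" "image_type K f M' r = p"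
proof -
  have M': "M' \<in> Kl" using M f iso_Kl by blast
  obtain a N where a: "p = gtp K a M' N" "M' \<preceq> N" "a \<in> univ N" "N \<in> Kl" by (rule gSE_small[OF p M']) blast
  let ?f = "inv_into (univ M) f"
  obtain g N' where g: "is_iso (voc K) g N N'" "\<And>x. x \<in> univ M' \<Longrightarrow> g x = ?f x"
    "M \<preceq> N'" by (rule iso_extend[OF is_iso_inv[OF f] a(2,4) M']) blast
  let ?g = "inv_into (univ N) g"
  have ga: "g a \<in> univ N'" "?g (g a) = a" using g(1) a(3) by (auto simp: is_iso_def bij_betw_def)
  have *: "?g x = f x" if "x \<in> univ M" for x
  proof -
    have "f x \<in> univ M'" "?f (f x) = x" using f that by (auto simp: is_iso_def bij_betw_def)
    then have "g (f x) = x" "f x \<in> univ N" using g(2) a(2) leD(4) by auto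
    then show ?thesis using g(1) by (metis bij_betw_inv_into_left is_iso_def)
  qed
  show thesis
    using that[OF gtp_in_gS[OF g(3) ga(1)]]
      image_type_gtp[OF M g(3) ga(1) is_iso_inv[OF g(1)] f *] ga(2) a(1) by simp
qed

lemma restrict_image_type_fixing:
  assumes p: "p \<in> gS K M" and M: "M \<in> Kl" and f: "is_iso (voc K) f M M'"
    and M0: "M0 \<preceq> M" "fixes_pointwise f M0"
  shows "restrict_type K (image_type K f M' p) M0 = restrict_type K p M0"
proof -
  obtain a N where a: "p = gtp K a M N" "M \<preceq> N" "a \<in> univ N" "N \<in> Kl" by (rule gSE_small[OF p M]) blast
  obtain g N' where g: "is_iso (voc K) g N N'" "\<And>x. x \<in> univ M \<Longrightarrow> g x = f x"
    "M' \<preceq> N'" by (rule iso_extend[OF f a(2,4) M]) blast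
  have ga: "g a \<in> univ N'" using g(1) a(3) by (auto simp: is_iso_def bij_betw_def)
  have "is_iso (voc K) f M0 M0"
    using M0 model_struct leD(1) is_iso_fixing by blast
  then have le: "M0 \<preceq> M'" using le_iso M0(1) f by blast
  have "fixes_pointwise g M0"
    using M0 g(2) leD(4)[OF M0(1)] by (auto simp: fixes_pointwise_def)
  then have "gtp K (g a) M0 N' = gtp K a M0 N"
    using gtp_iso_fixing[OF le_trans[OF M0(1) a(2)] a(3) g(1)] by simp
  then show ?thesis
    using image_type_gtp[OF M a(2,3) g(1) f g(2)] restrict_type_gtp[OF g(3) ga le]
      restrict_type_gtp[OF a(2,3) M0(1)] a(1) by simp
qed


section \<open>Universal extensions and splitting\<close>

lemma universal_overD:
  assumes "universal_over K lam M0 M"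
  shows "M0 \<in> Kl" "M \<in> Kl" "M0 \<preceq> M"
  using assms by (simp_all add: universal_over_def)

lemma universal_overE:
  assumes "universal_over K lam M0 M" "N \<in> Kl" "M0 \<preceq> N"
  obtains h where "K_embedding K h N M" "fixes_pointwise h M0"
  using assms unfolding universal_over_def by blast

lemma universal_over_trans_le:
  assumes "universal_over K lam M0 M" "M \<preceq> N" "N \<in> Kl"
  shows "universal_over K lam M0 N"
proof -
  have "K_embedding K h P N" if "K_embedding K h P M" for h P
    using that assms(2) le_trans unfolding K_embedding_def by blast
  then show ?thesis
    using assms le_trans unfolding universal_over_def by blast
qed

text \<open>An extension of A' is carried back above A, embedded into B and carried forth again; on
  A' this round trip is the identity.\<close>

lemma universal_over_iso:
  assumes u: "universal_over K lam A B" and e: "is_iso (voc K) e B B'" "is_iso (voc K) e A A'"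
  shows "universal_over K lam A' B'"
  unfolding universal_over_def
proof (intro conjI ballI impI)
  note AB = universal_overD[OF u]
  show A': "A' \<in> Kl" and B': "B' \<in> Kl" and "A' \<preceq> B'" using AB e iso_Kl le_iso by blast+
  fix N assume N: "N \<in> Kl" "A' \<preceq> N"
  obtain g N' where g: "is_iso (voc K) g N N'" "\<And>x. x \<in> univ A' \<Longrightarrow> g x = inv_into (univ A) e x"
    "A \<preceq> N'" "N' \<in> Kl"
    by (rule iso_extend[OF is_iso_inv[OF e(2)] N(2,1) A']) blast
  obtain h where h: "K_embedding K h N' B" "fixes_pointwise h A"
    by (rule universal_overE[OF u g(4,3)]) blast
  show "\<exists>h. K_embedding K h N B' \<and> fixes_pointwise h A'"
  proof (intro exI conjI)
    have "K_embedding K g N N'" "K_embedding K e B B'"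
      using g(1,4) e(1) B' KlD(1) le_refl iso_K_embedding by blast+
    then show "K_embedding K (e \<circ> (h \<circ> g)) N B'" using K_embedding_comp h(1) by blast
    have "e (h (g y)) = y" if "y \<in> univ A'" for y
    proof -
      obtain x where "x \<in> univ A" "y = e x"
        by (rule is_iso_imageE[OF e(2) \<open>y \<in> univ A'\<close>])
      moreover from this have "g y = x"
        using g(2)[OF that] e(2) by (auto simp: is_iso_def bij_betw_def)
      ultimately show ?thesis using h(2) by (simp add: fixes_pointwise_def)
    qed
    then show "fixes_pointwise (e \<circ> (h \<circ> g)) A'" by (simp add: fixes_pointwise_def)
  qed
qed

lemma splits_base_mono:
  assumes "splits K lam p N M1" "M0 \<preceq> M1"
  shows "splits K lam p N M0"
proof -
  obtain N1 N2 f where *: "N1 \<in> Kl" "N2 \<in> Kl" "M1 \<preceq> N1" "N1 \<preceq> N" "M1 \<preceq> N2" "N2 \<preceq> N"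
    "is_iso (voc K) f N1 N2" "fixes_pointwise f M1"
    "image_type K f N2 (restrict_type K p N1) \<noteq> restrict_type K p N2"
    using assms(1) unfolding splits_def by blast
  have "M0 \<preceq> N1" "M0 \<preceq> N2" "fixes_pointwise f M0"
    using * assms(2) le_trans fixes_pointwise_mono by blast+
  with * show ?thesis unfolding splits_def by blast
qed

text \<open>Weak uniqueness: \<open>M\<close> embeds over \<open>B\<close> into \<open>N\<close>, on whose image the types agree; not splitting
  carries this back to \<open>M\<close>.\<close>

lemma eq_if_not_splits:
  assumes p: "p \<in> gS K M" and q: "q \<in> gS K M" and M: "M \<in> Kl"
    and u: "universal_over K lam B N" and N: "N \<preceq> M"
    and ns: "\<not> splits K lam p M B" "\<not> splits K lam q M B"
    and eq: "restrict_type K p N = restrict_type K q N"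
  shows "p = q"
proof -
  note B = universal_overD[OF u]
  have BM: "B \<preceq> M" using B(3) N le_trans by blast
  obtain t where t: "K_embedding K t M N" "fixes_pointwise t B"
    by (rule universal_overE[OF u M BM]) blast
  obtain M' where M': "is_iso (voc K) t M M'" "M' \<preceq> N" using t(1) by (rule K_embeddingE) blast
  have M'_Kl: "M' \<in> Kl" using M' M iso_Kl by blast
  have M'M: "M' \<preceq> M" using M'(2) N le_trans by blast
  have "is_iso (voc K) t B B" using t(2) B(3) leD(1) model_struct is_iso_fixing by blast
  then have BM': "B \<preceq> M'" using le_iso[OF BM M'(1)] by blast
  \<comment> \<open>Not splitting is tested on M itself and its image M', with t as the isomorphism;
    the restriction of r to M is r.\<close>
  have *: "image_type K t M' r = restrict_type K r M'"
    if "r \<in> gS K M" "\<not> splits K lam r M B" for r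
    using that restrict_type_self[OF that(1)] M M'_Kl BM BM' M'M M'(1) t(2) KlD(1)[OF M] le_refl[of M]
    unfolding splits_def by metis
  have "restrict_type K p M' = restrict_type K q M'"
    using restrict_type_restrict_type[OF p N M'(2)] restrict_type_restrict_type[OF q N M'(2)] eq by simp
  then show ?thesis
    using image_type_inj[OF p q M M'(1)] * p q ns by simp
qed

end


section \<open>Independence relations\<close>

locale aec_indep = aec_card K lam
  for K :: "('a, 'f, 'r) abs_class" (structure) and lam :: "'a rel" +
  fixes I :: "('a, 'f, 'r) indep"
  assumes indep: "independence_relation K lam I"
    and uniq: "uniqueness K lam I"
    and ext: "extension K lam I"
begin

lemmas indep_conjuncts = indep[unfolded independence_relation_def]

lemma indepD:
  assumes "I M0 a M N"
  shows "M0 \<in> Kl" "M \<in> Kl" "N \<in> Kl" "M0 \<preceq> M" "M \<preceq> N" "a \<in> univ N"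
  using indep_conjuncts[THEN conjunct1, rule_format, OF assms] by blast+

lemma indep_iso:
  "I M0 a M N \<Longrightarrow> is_iso (voc K) h N N' \<Longrightarrow> is_iso (voc K) h M M' \<Longrightarrow> is_iso (voc K) h M0 M0' \<Longrightarrow>
    I M0' (h a) M' N'"
  by (rule indep_conjuncts[THEN conjunct2, THEN conjunct1, rule_format]) blast

lemma indep_mono:
  "I M0 a M N \<Longrightarrow> M' \<in> Kl \<Longrightarrow> M0 \<preceq> M' \<Longrightarrow> M' \<preceq> M \<Longrightarrow> I M0 a M' N"
  by (rule indep_conjuncts[THEN conjunct2, THEN conjunct2, THEN conjunct1, rule_format]) blast

lemma indep_base_mono:
  "I M0 a M N \<Longrightarrow> M0' \<in> Kl \<Longrightarrow> M0 \<preceq> M0' \<Longrightarrow> M0' \<preceq> M \<Longrightarrow> I M0' a M N"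
  by (rule indep_conjuncts[THEN conjunct2, THEN conjunct2, THEN conjunct2, THEN conjunct2,
      THEN conjunct2, rule_format]) blast

text \<open>\<open>nonforking\<close> does not name the model over which p is a type, but
  representatives carry their base, so p determines it.\<close>

lemma nonforkingE:
  assumes "nonforking K I p M0" "p \<in> gS K M"
  obtains a N where "p = gtp K a M N" "I M0 a M N"
proof -
  obtain a M' N where a: "p = gtp K a M' N" "I M0 a M' N"
    using assms(1) unfolding nonforking_def by blast
  obtain b P where b: "p = gtp K b M P" using assms(2) by (rule gSE) blast
  have "(a, M', N) \<in> gtp K b M P" using gtp_mem[OF indepD(5,6)[OF a(2)]] a(1) b by simp
  then have "M' = M" by (rule gtp_memD)
  then show thesis using that a by blast
qed

lemma nonforkingD:
  assumes "nonforking K I p M0" "p \<in> gS K M"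
  shows "M0 \<in> Kl" "M \<in> Kl" "M0 \<preceq> M"
  by (rule nonforkingE[OF assms], erule indepD)+

lemma nonforking_base_mono:
  assumes "nonforking K I p M0" "p \<in> gS K M" "M1 \<in> Kl" "M0 \<preceq> M1" "M1 \<preceq> M"
  shows "nonforking K I p M1"
  by (rule nonforkingE[OF assms(1,2)])
    (use assms(3-5) indep_base_mono in \<open>unfold nonforking_def, blast\<close>)

lemma nonforking_restrict:
  assumes "nonforking K I p M0" "p \<in> gS K M" "M' \<in> Kl" "M0 \<preceq> M'" "M' \<preceq> M"
  shows "nonforking K I (restrict_type K p M') M0"
proof (rule nonforkingE[OF assms(1,2)])
  fix a N assume a: "p = gtp K a M N" "I M0 a M N"
  have "restrict_type K p M' = gtp K a M' N"
    using restrict_type_gtp[OF indepD(5,6)[OF a(2)] assms(5)] a(1) by simp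
  moreover have "I M0 a M' N" using indep_mono a assms by blast
  ultimately show ?thesis unfolding nonforking_def by blast
qed

lemma nonforking_image:
  assumes "nonforking K I p M0" "p \<in> gS K M" "is_iso (voc K) f M M'" "is_iso (voc K) f M0 M0'"
  shows "nonforking K I (image_type K f M' p) M0'"
proof (rule nonforkingE[OF assms(1,2)])
  fix a N assume a: "p = gtp K a M N" "I M0 a M N"
  note d = indepD[OF a(2)]
  obtain g N' where g: "is_iso (voc K) g N N'" "\<And>x. x \<in> univ M \<Longrightarrow> g x = f x"
    "is_iso (voc K) g M M'"
    by (rule iso_extend[OF assms(3) d(5,3,2)]) blast
  have "is_iso (voc K) g M0 M0'"
    using is_iso_cong[OF assms(4)] g(2) leD(4)[OF d(4)] by (metis subsetD)
  then have "I M0' (g a) M' N'" using indep_iso a(2) g by blast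
  then show ?thesis
    using image_type_gtp[OF d(2,5,6) g(1) assms(3) g(2)] a(1) unfolding nonforking_def by blast
qed

lemma nonforking_unique:
  assumes "nonforking K I p M0" "nonforking K I q M0" "p \<in> gS K M" "q \<in> gS K M"
    and "restrict_type K p M0 = restrict_type K q M0"
  shows "p = q"
  using uniq assms nonforkingD[OF assms(1,3)] unfolding uniqueness_def by blast

lemma nonforking_extend:
  assumes "nonforking K I p M0" "p \<in> gS K M" "M \<preceq> N" "N \<in> Kl"
  obtains q where "q \<in> gS K N" "restrict_type K q M = p" "nonforking K I q M0"
  using ext assms nonforkingD[OF assms(1,2)] unfolding extension_def by blast

text \<open>Transitivity is derived, not assumed: the restriction of p to L extends over M without
  forking over \<open>M0\<close>; by base monotonicity the extension does not fork over L either, so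
  by uniqueness it is p.\<close>

lemma nonforking_trans:
  assumes p: "p \<in> gS K M" and L: "nonforking K I p L" and M0: "nonforking K I (restrict_type K p L) M0"
  shows "nonforking K I p M0"
proof -
  note d = nonforkingD[OF L p]
  have pL: "restrict_type K p L \<in> gS K L" using p d(3) by (rule restrict_type_in_gS)
  note d0 = nonforkingD[OF M0 pL]
  obtain q where q: "q \<in> gS K M" "restrict_type K q L = restrict_type K p L" "nonforking K I q M0"
    by (rule nonforking_extend[OF M0 pL d(3,2)]) blast
  have "nonforking K I q L" using nonforking_base_mono[OF q(3,1) d(1) d0(3) d(3)] .
  then have "p = q" using nonforking_unique[OF L _ p q(1)] q(2) by simp
  then show ?thesis using q(3) by simp
qed

text \<open>The image of one restriction and the other restriction do not fork over
  \<open>M0\<close>, by invariance and monotonicity. They agree on \<open>M0\<close>, which f fixes,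
  so uniqueness identifies them.\<close>

lemma nonforking_not_splits:
  assumes p: "p \<in> gS K M" and nf: "nonforking K I p M0"
  shows "\<not> splits K lam p M M0"
proof
  assume "splits K lam p M M0"
  then obtain N1 N2 f where *: "N1 \<in> Kl" "N2 \<in> Kl" "M0 \<preceq> N1" "N1 \<preceq> M" "M0 \<preceq> N2" "N2 \<preceq> M"
    "is_iso (voc K) f N1 N2" "fixes_pointwise f M0"
    "image_type K f N2 (restrict_type K p N1) \<noteq> restrict_type K p N2"
    unfolding splits_def by blast
  let ?p1 = "restrict_type K p N1" and ?p2 = "restrict_type K p N2"
  have gS: "?p1 \<in> gS K N1" "?p2 \<in> gS K N2" "image_type K f N2 ?p1 \<in> gS K N2"
    using p * restrict_type_in_gS image_type_in_gS by blast+
  have "is_iso (voc K) f M0 M0"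
    using *(3,8) leD(1) model_struct is_iso_fixing by blast
  then have "nonforking K I (image_type K f N2 ?p1) M0" "nonforking K I ?p2 M0"
    using nonforking_image[OF nonforking_restrict[OF nf p]] nonforking_restrict[OF nf p] gS * by blast+
  moreover have "restrict_type K (image_type K f N2 ?p1) M0 = restrict_type K ?p2 M0"
    using restrict_image_type_fixing[OF gS(1) *(1,7,3,8)]
      restrict_type_restrict_type[OF p *(4,3)] restrict_type_restrict_type[OF p *(6,5)] by simp
  ultimately show False using nonforking_unique gS *(9) by blast
qed

text \<open>\<open>C\<close> plays the role of the set of models of a chain of union \<open>L\<close>.\<close>

definition resolves :: "('a, 'f, 'r) struct set \<Rightarrow> ('a, 'f, 'r) struct \<Rightarrow> bool" where
  "resolves C L \<longleftrightarrow> C \<noteq> {} \<and> (\<forall>A\<in>C. universal_over K lam A L) \<and>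
     (\<forall>A\<in>C. \<forall>B\<in>C. A \<preceq> B \<or> B \<preceq> A) \<and> (\<forall>A\<in>C. \<exists>B\<in>C. universal_over K lam A B) \<and>
     (\<forall>p\<in>gS K L. \<exists>A\<in>C. nonforking K I p A)"

lemma resolves_lam_nonforking:
  assumes C: "resolves C L" and p: "p \<in> gS K M" and nf: "nonforking K I p L"
  shows "lam_nonforking K lam p M L"
proof -
  have "restrict_type K p L \<in> gS K L"
    using restrict_type_in_gS[OF p] nonforkingD[OF nf p] by blast
  then obtain A where A: "A \<in> C" "nonforking K I (restrict_type K p L) A"
    using C unfolding resolves_def by blast
  have "universal_over K lam A L" using C A(1) unfolding resolves_def by blast
  then show ?thesis
    using nonforking_not_splits[OF p nonforking_trans[OF p nf A(2)]] universal_overD(1)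
    unfolding lam_nonforking_def by blast
qed

text \<open>An isomorphic copy of the chain, with union inside \<open>L\<close>, goes through models above \<open>M0\<close>.\<close>

lemma resolves_copy:
  assumes C: "resolves C L" and u: "universal_over K lam M0 L"
  obtains e L' A where "is_iso (voc K) e L L'" "L' \<preceq> L" "A \<in> C"
    "\<And>B B'. A \<preceq> B \<Longrightarrow> is_iso (voc K) e B B' \<Longrightarrow> B \<preceq> L \<Longrightarrow> M0 \<preceq> B'"
proof -
  note M0 = universal_overD[OF u]
  \<comment> \<open>A is taken universal over an earlier \<open>A0\<close>: since L extends
    \<open>A0\<close>, this universality is what embeds L into A.\<close>
  obtain A0 A where A: "A \<in> C" "universal_over K lam A0 A" "A0 \<preceq> L"
    using C universal_overD(3) unfolding resolves_def by blast
  have AL: "universal_over K lam A L" using C A(1) unfolding resolves_def by blast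
  note ALD = universal_overD[OF AL]
  obtain h where "K_embedding K h L A" by (rule universal_overE[OF A(2) M0(2) A(3)])
  then have "K_embedding K h M0 A" by (rule K_embedding_restrict[OF M0(3)])
  then obtain M0' where M0': "is_iso (voc K) h M0 M0'" "M0' \<preceq> A" by (rule K_embeddingE)
  have M0'_Kl: "M0' \<in> Kl" using M0' M0 iso_Kl by blast
  \<comment> \<open>g undoes h on the image \<open>M0'\<close> of \<open>M0\<close>, so the copy
    \<open>L1\<close> of L lies above \<open>M0\<close>.\<close>
  obtain g L1 where g: "is_iso (voc K) g L L1" "is_iso (voc K) g M0' M0" "M0 \<preceq> L1" "L1 \<in> Kl"
    by (rule iso_extend[OF is_iso_inv[OF M0'(1)] le_trans[OF M0'(2) ALD(3)] M0(2) M0'_Kl]) blast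
  \<comment> \<open>Universality of L over \<open>M0\<close> brings \<open>L1\<close> back into L
    without moving \<open>M0\<close>. The composite sends \<open>M0'\<close>, which lies below A,
    onto \<open>M0\<close>.\<close>
  obtain k where k: "K_embedding K k L1 L" "fixes_pointwise k M0"
    by (rule universal_overE[OF u g(4,3)])
  obtain L' where L': "is_iso (voc K) k L1 L'" "L' \<preceq> L" using k(1) by (rule K_embeddingE)
  have "is_iso (voc K) k M0 M0" using k(2) M0(1) KlD(1) model_struct is_iso_fixing by blast
  then have e0: "is_iso (voc K) (k \<circ> g) M0' M0" using g(2) is_iso_comp by blast
  show thesis
  proof (rule that[OF is_iso_comp[OF g(1) L'(1)] L'(2) A(1)])
    fix B B' assume "A \<preceq> B" "is_iso (voc K) (k \<circ> g) B B'"
    then show "M0 \<preceq> B'" using e0 M0'(2) le_trans le_iso by blast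
  qed
qed

lemma resolves_nonforking:
  assumes C: "resolves C L" and p: "p \<in> gS K M" and L: "L \<preceq> M" and M: "M \<in> Kl"
    and nf: "lam_nonforking K lam p M L"
  shows "nonforking K I p L"
proof -
  obtain M0 where u: "universal_over K lam M0 L" and ns: "\<not> splits K lam p M M0"
    using nf unfolding lam_nonforking_def by blast
  obtain e L' A where e: "is_iso (voc K) e L L'" and L': "L' \<preceq> L" and A: "A \<in> C"
    and M0_le: "\<And>B B'. A \<preceq> B \<Longrightarrow> is_iso (voc K) e B B' \<Longrightarrow> B \<preceq> L \<Longrightarrow> M0 \<preceq> B'"
    by (rule resolves_copy[OF C u]) blast
  have L_Kl: "L \<in> Kl" using universal_overD(2)[OF u] .
  have L'M: "L' \<preceq> M" using L' L le_trans by blast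
  let ?p = "restrict_type K p L'"
  have p': "?p \<in> gS K L'" using p L'M by (rule restrict_type_in_gS)
  \<comment> \<open>Local character is at hand for types over L only, so the restriction of p to L'
    is pulled back along e.\<close>
  obtain r where r: "r \<in> gS K L" "image_type K e L' r = ?p"
    by (rule image_type_surj[OF p' L_Kl e])
  obtain D where D: "D \<in> C" "nonforking K I r D" using C r(1) unfolding resolves_def by blast
  \<comment> \<open>Local character may pick a model below A, whose copy need not contain
    \<open>M0\<close>. Base monotonicity then raises the base to A.\<close>
  obtain B where B: "B \<in> C" "A \<preceq> B" "nonforking K I r B"
  proof (cases "A \<preceq> D")
    case True
    then show thesis using that D by blast
  next
    case False
    then have "D \<preceq> A" using C A D(1) unfolding resolves_def by blast
    moreover have "A \<in> Kl" "A \<preceq> L" using C A universal_overD unfolding resolves_def by blast+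
    ultimately have "nonforking K I r A" using nonforking_base_mono D(2) r(1) by blast
    then show thesis using that[OF A] \<open>A \<in> Kl\<close> KlD(1) le_refl by blast
  qed
  have uB: "universal_over K lam B L" using C B(1) unfolding resolves_def by blast
  obtain B' where B': "is_iso (voc K) e B B'" "B' \<preceq> L'"
    by (rule iso_submodel[OF e universal_overD(3)[OF uB]]) blast
  have uB': "universal_over K lam B' L'" using universal_over_iso uB e B'(1) by blast
  have M0B': "M0 \<preceq> B'" using M0_le B(2) B'(1) universal_overD(3)[OF uB] by blast
  have nfB': "nonforking K I ?p B'" using nonforking_image[OF B(3) r(1) e B'(1)] r(2) by simp
  obtain q where q: "q \<in> gS K M" "restrict_type K q L' = ?p" "nonforking K I q B'"
    by (rule nonforking_extend[OF nfB' p' L'M M])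
  have "\<not> splits K lam p M B'" using ns M0B' splits_base_mono by blast
  then have "p = q"
    using eq_if_not_splits[OF p q(1) M uB' L'M _ nonforking_not_splits[OF q(1,3)]] q(2) by simp
  then have "nonforking K I p B'" using q(3) by simp
  \<comment> \<open>Since B' lies inside L' and hence inside L, the base may be enlarged to
    L.\<close>
  then show ?thesis
    using nonforking_base_mono[OF _ p L_Kl le_trans[OF B'(2) L'] L] by blast
qed

end


section \<open>Limit models\<close>

lemma limit_ord_succ:
  assumes "limit_ord r" "i \<in> Field r"
  obtains j where "is_succ_of r i j"
proof -
  interpret wo_rel r using assms(1) by (simp add: limit_ord_def wo_rel_def)
  let ?S = "{j \<in> Field r. j \<noteq> i \<and> (i, j) \<in> r}"
  have "?S \<noteq> {}" using assms unfolding limit_ord_def by blast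
  then have "minim ?S \<in> ?S" using minim_in[of ?S] by blast
  moreover have "(minim ?S, k) \<in> r" if "k \<noteq> i" "(i, k) \<in> r" for k
    using minim_least[of ?S k] that by (auto simp: Field_def)
  ultimately show thesis using that unfolding is_succ_of_def by blast
qed

text \<open>The given cardinal \<kappa> is a witness for the property minimised by
  \<open>kappa\<close>, since its local character covers continuous chains in particular. So
  \<open>kappa\<close> is well defined and has the property too.\<close>

lemma kappa_local_character:
  fixes lam \<kappa> \<delta> :: "'a rel" and K :: "('a, 'f, 'r) abs_class"
  assumes \<kappa>: "regular \<kappa>" "\<kappa> \<le>o lam" "local_character_ge K lam I \<kappa>"
    and \<delta>: "regular \<delta>" "kappa K lam I \<le>o \<delta>" "\<delta> <o cardSuc lam"
    and M: "universal_chain K lam \<delta> M" "continuous_chain (voc K) \<delta> M"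
    and p: "p \<in> gS K (union_struct (voc K) (Field \<delta>) M)"
  obtains i where "i \<in> Field \<delta>" "nonforking K I p (M i)"
proof -
  let ?P = "\<lambda>\<mu>. \<mu> \<le>o lam \<and> (\<forall>\<delta> :: 'a rel. regular \<delta> \<and> \<mu> \<le>o \<delta> \<and> \<delta> <o cardSuc lam \<longrightarrow>
        (\<forall>M. universal_chain K lam \<delta> M \<and> continuous_chain (voc K) \<delta> M \<longrightarrow>
           (\<forall>p\<in>gS K (union_struct (voc K) (Field \<delta>) M). \<exists>i\<in>Field \<delta>. nonforking K I p (M i))))"
  have "?P \<kappa>" using \<kappa>(2,3) unfolding local_character_ge_def local_character_def by blast
  moreover have "Card_order \<kappa>" using \<kappa>(1) by (simp add: regular_def)
  ultimately have "?P (kappa K lam I)"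
    using least_card_prop[of \<kappa> ?P] unfolding kappa_def by blast
  then show thesis using that \<delta> M p by blast
qed

text \<open>C is the set of models in the defining chain. Local character applies to types over L
  because the length of the chain is regular and at least \<open>kappa\<close>.\<close>

lemma (in aec_indep) limit_model_resolves:
  assumes \<kappa>: "regular \<kappa>" "\<kappa> \<le>o lam" "local_character_ge K lam I \<kappa>"
    and L: "limit_model_ge K lam (kappa K lam I) L" "L \<in> Kl"
  obtains C where "resolves C L"
proof -
  obtain \<delta> :: "'a rel" where \<delta>: "regular \<delta>" "kappa K lam I \<le>o \<delta>" "\<delta> <o cardSuc lam"
    and lim: "limit_model K lam \<delta> L"
    using L(1) unfolding limit_model_ge_def by blast
  obtain M where ord: "limit_ord \<delta>" and M: "\<forall>i\<in>Field \<delta>. M i \<in> Kl"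
    and inc: "increasing (le K) \<delta> M" and cont: "continuous_chain (voc K) \<delta> M"
    and succ: "\<forall>i j. is_succ_of \<delta> i j \<longrightarrow> universal_over K lam (M i) (M j)"
    and union: "L = union_struct (voc K) (Field \<delta>) M"
    using lim unfolding limit_model_def by blast
  have le_L: "M i \<preceq> L" if "i \<in> Field \<delta>" for i
    using le_union_struct[OF ord _ inc that] M KlD(1) union by blast
  have mono: "M i \<preceq> M j" if "(i, j) \<in> \<delta>" for i j
  proof (cases "i = j")
    case True
    have "j \<in> Field \<delta>" using that by (simp add: FieldI2)
    then show ?thesis using True M KlD(1) le_refl by blast
  next
    case False
    then show ?thesis using inc that unfolding increasing_def by blast
  qed
  \<comment> \<open>The definition grants universality only at immediate successors. For later j the
    model at j extends the one at the successor of i, and universality persists upwards.\<close>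
  have univ: "universal_over K lam (M i) (M j)" if "(i, j) \<in> \<delta>" "i \<noteq> j" for i j
  proof -
    have ij: "i \<in> Field \<delta>" "j \<in> Field \<delta>" using that by (auto simp: Field_def)
    obtain k where k: "is_succ_of \<delta> i k" by (rule limit_ord_succ[OF ord ij(1)])
    have "(k, j) \<in> \<delta>" using k that unfolding is_succ_of_def by metis
    moreover have "M j \<in> Kl" using M ij(2) by (rule bspec)
    ultimately show ?thesis
      using universal_over_trans_le[OF succ[rule_format, OF k]] mono by simp
  qed
  have chain: "universal_chain K lam \<delta> M"
    using M univ unfolding universal_chain_def increasing_def by blast
  have next_M: "\<exists>j\<in>Field \<delta>. universal_over K lam (M i) (M j)" if "i \<in> Field \<delta>" for i
    using ord that univ unfolding limit_ord_def by blast
  have "resolves (M ` Field \<delta>) L"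
    unfolding resolves_def
  proof (intro conjI ballI)
    show "M ` Field \<delta> \<noteq> {}" using ord by (simp add: limit_ord_def)
    fix A assume "A \<in> M ` Field \<delta>"
    then obtain i where i: "i \<in> Field \<delta>" "A = M i" by blast
    then show "universal_over K lam A L" "\<exists>B\<in>M ` Field \<delta>. universal_over K lam A B"
      using next_M[OF i(1)] universal_over_trans_le[OF _ le_L L(2)] by blast+
    fix B assume "B \<in> M ` Field \<delta>"
    then obtain j where j: "j \<in> Field \<delta>" "B = M j" by blast
    have "(i, j) \<in> \<delta> \<or> (j, i) \<in> \<delta>"
      using ord i(1) j(1) wo_rel.TOTALS[of \<delta>] by (auto simp: limit_ord_def wo_rel_def)
    then show "A \<preceq> B \<or> B \<preceq> A" using mono i j by blast
  next
    fix p assume "p \<in> gS K L"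
    then have "p \<in> gS K (union_struct (voc K) (Field \<delta>) M)" using union by simp
    then obtain i where "i \<in> Field \<delta>" "nonforking K I p (M i)"
      by (rule kappa_local_character[OF \<kappa> \<delta> chain cont])
    then show "\<exists>A\<in>M ` Field \<delta>. nonforking K I p A" by blast
  qed
  then show thesis by (rule that)
qed

theorem theorem4p10:
  fixes K :: "('a, 'f, 'r) abs_class"
    and lam \<kappa> :: "'a rel"
    and I :: "('a, 'f, 'r) indep"
    and L M :: "('a, 'f, 'r) struct"
    and p :: "('a, 'f, 'r) gtype"
  assumes "AEC K"
    and "Card_order lam" and "LS K \<le>o lam"
    and "stable_in K lam"
    and "amalgamation K lam" and "joint_embedding K lam" and "no_maximal_models K lam"
    and "independence_relation K lam I"
    and "uniqueness K lam I" and "extension K lam I" and "universal_continuity K lam I"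
    and "regular \<kappa>" and "\<kappa> \<le>o lam" and "local_character_ge K lam I \<kappa>"
    and "L \<in> models_of_card K lam" and "M \<in> models_of_card K lam" and "L \<preceq>\<^bsub>K\<^esub> M"
    and "limit_model_ge K lam (kappa K lam I) L"
    and "p \<in> gS K M"
  shows "lam_nonforking K lam p M L \<longleftrightarrow> nonforking K I p L"
proof -
  have room: "lam <o |UNIV :: 'a set|"
    using universe_larger[OF \<open>AEC K\<close> \<open>no_maximal_models K lam\<close> \<open>L \<in> models_of_card K lam\<close>] .
  interpret aec_indep K lam I
    using assms room by unfold_locales
  obtain C where "resolves C L"
    by (rule limit_model_resolves[OF \<open>regular \<kappa>\<close> \<open>\<kappa> \<le>o lam\<close> \<open>local_character_ge K lam I \<kappa>\<close>
          \<open>limit_model_ge K lam (kappa K lam I) L\<close> \<open>L \<in> models_of_card K lam\<close>])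
  then show ?thesis
    using resolves_lam_nonforking resolves_nonforking \<open>p \<in> gS K M\<close> \<open>L \<preceq>\<^bsub>K\<^esub> M\<close>
      \<open>M \<in> models_of_card K lam\<close> by blast
qed

end
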